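(* Let $\mathfrak M$ be a Hilbert space, let $\mathcal E:=\mathbb C\setminus\{(-\infty,-1]\cup[1,+\infty)\}$, and let $\Omega$ be a $\mathbf B(\mathfrak M)$-valued Nevanlinna function which is defined and holomorphic on $\mathcal E$. Then the following statements are equivalent: (i) $\Omega$ belongs to the class $\mathcal{RS}(\mathfrak M)$; (ii) $\Omega$ satisfies the inequality $$I-\Omega^*(z)\Omega(z)-(1-|z|^2)\frac{\operatorname{Im}\Omega(z)}{\operatorname{Im}z}\ge 0,\qquad \operatorname{Im}z\neq 0;$$ (iii) the function $$K(z,w):=I-\Omega^*(w)\Omega(z)-\frac{1-\bar w z}{z-\bar w}\left(\Omega(z)-\Omega^*(w)\right)$$ is a nonnegative kernel on $\{z\in\mathcal E:\operatorname{Im}z>0\}$ and on $\{z\in\mathcal E:\operatorname{Im}z<0\}$; (iv) the function $$\Upsilon(z)=(zI-\Omega(z))(I-z\Omega(z))^{-1},\qquad z\in\mathcal E,$$ is well defined (i.e. $I-z\Omega(z)$ is boundedly invertible for each $z\in\mathcal E$) and belongs to $\mathcal{RS}(\mathfrak M)$.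
   Context: Hilbert spaces are complex and separable; $\mathbf B(\mathfrak M)$ is the algebra of bounded operators on $\mathfrak M$; $\Omega^*(z):=\Omega(z)^*$; $\operatorname{Im}S=(S-S^* )/(2i)$ for $S\in\mathbf B(\mathfrak M)$. A $\mathbf B(\mathfrak M)$-valued function $M$ is a Nevanlinna function if it is holomorphic outside the real axis, $M(\lambda)^*=M(\bar\lambda)$, and $\operatorname{Im}\lambda\,\operatorname{Im}M(\lambda)\ge0$ for all $\lambda\in\mathbb C\setminus\mathbb R$. The class $\mathcal{RS}(\mathfrak M)$ consists of all $\mathbf B(\mathfrak M)$-valued Nevanlinna functions $\Omega$ which are holomorphic on $\mathcal E$ and satisfy $-I\le\Omega(x)\le I$ for all $x\in(-1,1)$. A function $K(z,w)$ with values in $\mathbf B(\mathfrak M)$ is a nonnegative kernel on a set $S$ if $\sum_{k,m=1}^n (K(z_k,z_m)f_k,f_m)\ge 0$ for all $n$, all $z_1,\dots,z_n\in S$ and all $f_1,\dots,f_n\in\mathfrak M$. *)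

theory Defs
  imports "HOL-Analysis.Analysis"
begin

class scaleC =
  fixes scaleC :: "complex \<Rightarrow> 'a \<Rightarrow> 'a"  (infixr \<open>*\<^sub>C\<close> 75)

text \<open>A complex normed space is a real normed space with a compatible complex scalar
  multiplication, so that the norm, the topology and the bounded operators \<open>'a \<Rightarrow>\<^sub>L 'b\<close> of the
  library are available.\<close>

class complex_normed_vector = real_normed_vector + scaleC +
  assumes scaleC_add_right: "a *\<^sub>C (x + y) = a *\<^sub>C x + a *\<^sub>C y"
    and scaleC_add_left: "(a + b) *\<^sub>C x = a *\<^sub>C x + b *\<^sub>C x"
    and scaleC_scaleC: "a *\<^sub>C b *\<^sub>C x = (a * b) *\<^sub>C x"
    and scaleR_scaleC: "r *\<^sub>R x = complex_of_real r *\<^sub>C x"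
    and norm_scaleC: "norm (a *\<^sub>C x) = cmod a * norm x"

text \<open>The complex inner product is linear in its first argument; the real inner product of the
  superclass is its real part, so the norm is the one induced by \<open>cinner\<close>, and definiteness
  is inherited from \<^class>\<open>real_inner\<close>.\<close>

class complex_inner = complex_normed_vector + real_inner +
  fixes cinner :: "'a \<Rightarrow> 'a \<Rightarrow> complex"
  assumes cinner_commute: "cinner x y = cnj (cinner y x)"
    and cinner_add_left: "cinner (x + y) z = cinner x z + cinner y z"
    and cinner_scaleC_left: "cinner (a *\<^sub>C x) y = a * cinner x y"
    and inner_eq_Re_cinner: "inner x y = Re (cinner x y)"

class chilbert_space = complex_inner + complete_space

instantiation complex :: chilbert_space
begin

definition scaleC_complex :: "complex \<Rightarrow> complex \<Rightarrow> complex"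
  where "scaleC_complex a x = a * x"

definition cinner_complex :: "complex \<Rightarrow> complex \<Rightarrow> complex"
  where "cinner_complex x y = x * cnj y"

instance
  by standard
    (auto simp: scaleC_complex_def cinner_complex_def algebra_simps scaleR_conv_of_real
      norm_mult inner_complex_def)

end

lemma cinner_self: "cinner x x = complex_of_real ((norm x)\<^sup>2)"
proof (rule complex_eqI)
  show "Re (cinner x x) = Re (complex_of_real ((norm x)\<^sup>2))"
    by (simp add: power2_norm_eq_inner inner_eq_Re_cinner del: of_real_power)
  show "Im (cinner x x) = Im (complex_of_real ((norm x)\<^sup>2))"
    using arg_cong[OF cinner_commute[of x x], of Im] by (simp del: of_real_power)
qed

lemma bounded_linear_scaleC: "bounded_linear (\<lambda>x. c *\<^sub>C (x :: 'a :: complex_normed_vector))"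
proof (rule bounded_linear_intro[where K = "cmod c"])
  fix r :: real and x :: 'a
  show "c *\<^sub>C r *\<^sub>R x = r *\<^sub>R c *\<^sub>C x"
    by (simp add: scaleR_scaleC scaleC_scaleC mult.commute)
qed (auto simp: scaleC_add_right norm_scaleC mult.commute)

instantiation blinfun :: (real_normed_vector, complex_normed_vector) complex_normed_vector
begin

lift_definition scaleC_blinfun :: "complex \<Rightarrow> 'a \<Rightarrow>\<^sub>L 'b \<Rightarrow> 'a \<Rightarrow>\<^sub>L 'b" is "\<lambda>c f x. c *\<^sub>C f x"
  by (rule bounded_linear_compose[OF bounded_linear_scaleC])

instance
proof
  fix a :: complex and T :: "'a \<Rightarrow>\<^sub>L 'b"
  have le: "norm (a *\<^sub>C T) \<le> cmod a * norm T" for a :: complex and T :: "'a \<Rightarrow>\<^sub>L 'b"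
    by (rule norm_blinfun_bound)
      (auto simp: scaleC_blinfun.rep_eq norm_scaleC mult.assoc intro!: mult_left_mono norm_blinfun)
  have one: "1 *\<^sub>C x = x" for x :: 'b
    using scaleR_scaleC[of 1 x] by simp
  have inv: "inverse a *\<^sub>C a *\<^sub>C T = T" if "a \<noteq> 0"
    using that by (intro blinfun_eqI) (simp add: scaleC_blinfun.rep_eq scaleC_scaleC one)
  show "norm (a *\<^sub>C T) = cmod a * norm T"
  proof (cases "a = 0")
    case True
    then show ?thesis using le[of a T] by simp
  next
    case False
    have "norm T \<le> cmod (inverse a) * norm (a *\<^sub>C T)"
      using le[of "inverse a" "a *\<^sub>C T"] inv[OF False] by simp
    then have "cmod a * norm T \<le> norm (a *\<^sub>C T)"
      using False by (simp add: norm_divide divide_simps mult.commute)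
    with le[of a T] show ?thesis by simp
  qed
qed (transfer; rule ext; simp add: scaleC_add_right scaleC_add_left scaleC_scaleC scaleR_scaleC)+

end

text \<open>\<open>bops\<close> is the algebra B(M). The library type \<open>'a \<Rightarrow>\<^sub>L 'a\<close> consists of the
  bounded real-linear maps, hence the extra condition of complex homogeneity.\<close>

definition bops :: "('a :: complex_normed_vector \<Rightarrow>\<^sub>L 'a) set"
  where "bops = {T. \<forall>c x. blinfun_apply T (c *\<^sub>C x) = c *\<^sub>C blinfun_apply T x}"

text \<open>On a Hilbert space the adjoint exists for each \<open>T \<in> bops\<close> (Riesz) and is unique.\<close>

definition op_adj :: "('a :: chilbert_space \<Rightarrow>\<^sub>L 'a) \<Rightarrow> ('a \<Rightarrow>\<^sub>L 'a)"
  where "op_adj T = (THE S. S \<in> bops \<and>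
    (\<forall>x y. cinner (blinfun_apply T x) y = cinner x (blinfun_apply S y)))"

definition op_Im :: "('a :: chilbert_space \<Rightarrow>\<^sub>L 'a) \<Rightarrow> ('a \<Rightarrow>\<^sub>L 'a)"
  where "op_Im S = (1 / (2 * \<i>)) *\<^sub>C (S - op_adj S)"

text \<open>Membership in \<open>\<real>\<^sub>\<ge>\<^sub>0\<close> says that the complex number is real and nonnegative; in
  particular a nonnegative operator in \<open>bops\<close> is selfadjoint.\<close>

definition op_nonneg :: "('a :: chilbert_space \<Rightarrow>\<^sub>L 'a) \<Rightarrow> bool"
  where "op_nonneg T \<longleftrightarrow> (\<forall>f. cinner (blinfun_apply T f) f \<in> \<real>\<^sub>\<ge>\<^sub>0)"

definition op_le :: "('a :: chilbert_space \<Rightarrow>\<^sub>L 'a) \<Rightarrow> ('a \<Rightarrow>\<^sub>L 'a) \<Rightarrow> bool"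
  where "op_le A B \<longleftrightarrow> op_nonneg (B - A)"

definition boundedly_invertible :: "('a :: complex_normed_vector \<Rightarrow>\<^sub>L 'a) \<Rightarrow> bool"
  where "boundedly_invertible T \<longleftrightarrow>
    (\<exists>S\<in>bops. S o\<^sub>L T = id_blinfun \<and> T o\<^sub>L S = id_blinfun)"

definition op_inverse :: "('a :: complex_normed_vector \<Rightarrow>\<^sub>L 'a) \<Rightarrow> ('a \<Rightarrow>\<^sub>L 'a)"
  where "op_inverse T = (THE S. S \<in> bops \<and> S o\<^sub>L T = id_blinfun \<and> T o\<^sub>L S = id_blinfun)"

text \<open>Holomorphy of a B(M)-valued function: complex differentiability in the
  operator norm, the derivative at \<open>z\<close> being \<open>h \<mapsto> h *\<^sub>C D\<close>. The analogue for complex-valued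
  functions is \<^const>\<open>holomorphic_on\<close>.\<close>

definition op_holomorphic_on ::
    "(complex \<Rightarrow> ('a :: complex_normed_vector \<Rightarrow>\<^sub>L 'a)) \<Rightarrow> complex set \<Rightarrow> bool"
  where "op_holomorphic_on F S \<longleftrightarrow> (\<forall>z\<in>S. F z \<in> bops \<and>
    (\<exists>D\<in>bops. (F has_derivative (\<lambda>h. h *\<^sub>C D)) (at z within S)))"

definition nevanlinna :: "(complex \<Rightarrow> ('a :: chilbert_space \<Rightarrow>\<^sub>L 'a)) \<Rightarrow> bool"
  where "nevanlinna M \<longleftrightarrow> op_holomorphic_on M {z. Im z \<noteq> 0} \<and>
    (\<forall>z. Im z \<noteq> 0 \<longrightarrow> op_adj (M z) = M (cnj z) \<and> op_nonneg (Im z *\<^sub>R op_Im (M z)))"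

definition E_dom :: "complex set"
  where "E_dom = UNIV - complex_of_real ` ({..-1} \<union> {1..})"

text \<open>Functions are total in HOL; only their values on \<open>E_dom\<close> matter for membership in \<open>RS\<close>.\<close>

definition RS :: "(complex \<Rightarrow> ('a :: chilbert_space \<Rightarrow>\<^sub>L 'a)) set"
  where "RS = {F. nevanlinna F \<and> op_holomorphic_on F E_dom \<and>
    (\<forall>x\<in>{-1<..<1}. op_le (- id_blinfun) (F (complex_of_real x)) \<and>
                    op_le (F (complex_of_real x)) id_blinfun)}"

definition nonneg_kernel_on ::
    "complex set \<Rightarrow> (complex \<Rightarrow> complex \<Rightarrow> ('a :: chilbert_space \<Rightarrow>\<^sub>L 'a)) \<Rightarrow> bool"
  where "nonneg_kernel_on S K \<longleftrightarrow> (\<forall>z\<in>S. \<forall>w\<in>S. K z w \<in> bops) \<and>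
    (\<forall>(n::nat) (z :: nat \<Rightarrow> complex) (f :: nat \<Rightarrow> 'a). (\<forall>k<n. z k \<in> S) \<longrightarrow>
      (\<Sum>k<n. \<Sum>m<n. cinner (blinfun_apply (K (z k) (z m)) (f k)) (f m)) \<in> \<real>\<^sub>\<ge>\<^sub>0)"

definition K_kernel ::
    "(complex \<Rightarrow> ('a :: chilbert_space \<Rightarrow>\<^sub>L 'a)) \<Rightarrow> complex \<Rightarrow> complex \<Rightarrow> ('a \<Rightarrow>\<^sub>L 'a)"
  where "K_kernel \<Omega> z w = id_blinfun - (op_adj (\<Omega> w) o\<^sub>L \<Omega> z)
    - ((1 - cnj w * z) / (z - cnj w)) *\<^sub>C (\<Omega> z - op_adj (\<Omega> w))"

definition Upsilon ::
    "(complex \<Rightarrow> ('a :: chilbert_space \<Rightarrow>\<^sub>L 'a)) \<Rightarrow> complex \<Rightarrow> ('a \<Rightarrow>\<^sub>L 'a)"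
  where "Upsilon \<Omega> z =
    (z *\<^sub>C id_blinfun - \<Omega> z) o\<^sub>L op_inverse (id_blinfun - z *\<^sub>C \<Omega> z)"

end

(* In the coordinate z = 2 v / (1 + v^2) of the unit disc, Cauchy's formula turns the symmetry
   T(cnj u) = T(u)^* of T(u) = Omega(2 r u / (1 + (r u)^2)), r < 1, into an integral representation
   with nonnegative density sin t * Im T(e^(it)) and kernel z / (1 - z cos t). Inserting the bounds
   I + T(-r) >= 0 and I - T(r) >= 0, T(v) becomes an average, with respect to a nonnegative operator
   measure of total mass I, of scalar Blaschke factors b_t(z) = (z - t) / (1 - z t) up to scaling.
   For scalar b_t the kernel in (iii) vanishes, so for the average it is the variance of b_t, hence
   nonnegative; let r tend to 1. This is (i) => (iii), and (ii) is the diagonal of (iii). Statement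
   (ii) gives |Omega| <= 1 on (-1,1) by continuity. Finally (ii) says that Im z * Im Upsilon(z) >= 0,
   while I - z Omega(z) is invertible off the real axis because Omega(z) - 1/z is coercive. *)

theory Submission
  imports Defs "HOL-Complex_Analysis.Cauchy_Integral_Formula"
begin

section \<open>Complex Hilbert spaces and adjoints\<close>

text \<open>The obstacle is the measure: a Nevanlinna function on the whole domain has only a weak
  boundary measure, and a variance for it would call for a dilation. Shrinking the disc by r < 1
  makes the density continuous, so every integral is a scalar mean of <T u x, y>, and the
  sesquilinear form \<open>bform\<close> stands in for the operator density. The variance is then
  this form evaluated, at each point u of the circle, at the single vector
  \<open>\<Sum>k. beta (v k) u *\<^sub>C x k - T (v k) (x k)\<close>; expanding the square uses only
  moments up to order two. The density alone does not have mass I. The missing mass is (I +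
  T(-\<rho>)) / 2 + (I - T(\<rho>)) / 2, which is where the two bounds of the class enter. The
  bounds hold only inside (-1,1), hence the test points \<plusminus>\<rho> and the rescaling by s =
  \<open>joukowski \<rho>\<close> < 1, which disappears in the limit together with r. The same route
  supplies the contraction bound on (-1,1) for members of the class, which both directions of (i)
  <=> (iv) use.\<close>

lemma cinner_add_right: "cinner x (y + z) = cinner x y + cinner x z"
  by (metis cinner_commute cinner_add_left complex_cnj_add)

lemma cinner_scaleC_right: "cinner x (a *\<^sub>C y) = cnj a * cinner x y"
  by (metis cinner_commute cinner_scaleC_left complex_cnj_mult complex_cnj_cnj)

lemma cinner_zero_left [simp]: "cinner 0 y = 0"
  using cinner_add_left[of 0 0 y] by simp

lemma cinner_zero_right [simp]: "cinner x 0 = 0"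
  using cinner_add_right[of x 0 0] by simp

lemma cinner_minus_left: "cinner (- x) y = - cinner x y"
  using cinner_add_left[of x "- x" y] by (simp add: minus_unique)

lemma cinner_minus_right: "cinner x (- y) = - cinner x y"
  using cinner_add_right[of x y "- y"] by (simp add: minus_unique)

lemma cinner_diff_left: "cinner (x - y) z = cinner x z - cinner y z"
  using cinner_add_left[of x "- y" z] by (simp add: cinner_minus_left)

lemma cinner_diff_right: "cinner x (y - z) = cinner x y - cinner x z"
  using cinner_add_right[of x y "- z"] by (simp add: cinner_minus_right)

lemma cinner_scaleR_left: "cinner (r *\<^sub>R x) y = complex_of_real r * cinner x y"
  by (simp add: scaleR_scaleC cinner_scaleC_left)

lemma cinner_scaleR_right: "cinner x (r *\<^sub>R y) = complex_of_real r * cinner x y"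
  by (simp add: scaleR_scaleC cinner_scaleC_right)

lemmas cinner_simps = cinner_add_left cinner_add_right cinner_diff_left cinner_diff_right
  cinner_minus_left cinner_minus_right cinner_scaleC_left cinner_scaleC_right
  cinner_scaleR_left cinner_scaleR_right

lemma Im_cinner: "Im (cinner x y) = - inner (\<i> *\<^sub>C x) y"
  by (simp add: inner_eq_Re_cinner cinner_scaleC_left)

lemma norm_cinner_le: "cmod (cinner x y) \<le> norm x * norm y"
proof -
  \<comment> \<open>Rotating the inner product onto the positive axis reduces the claim to the real
    inequality. Since \<open>sgn 0 = 0\<close>, the modulus of \<open>c\<close> is at most 1 rather
    than always 1.\<close>
  define c where "c = cnj (sgn (cinner x y))"
  have "c * cinner x y = complex_of_real (cmod (cinner x y))"
    unfolding c_def by (cases "cinner x y = 0")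
      (auto simp: sgn_eq complex_norm_square[symmetric] field_simps power2_eq_square
        mult.commute[of "cnj _"] simp flip: of_real_mult)
  then have "cmod (cinner x y) = inner (c *\<^sub>C x) y"
    by (simp add: inner_eq_Re_cinner cinner_scaleC_left)
  also have "\<dots> \<le> cmod c * norm x * norm y"
    using norm_cauchy_schwarz[of "c *\<^sub>C x" y] by (simp add: norm_scaleC)
  also have "\<dots> \<le> 1 * norm x * norm y"
    by (intro mult_right_mono) (auto simp: c_def norm_sgn)
  finally show ?thesis by simp
qed

lemma bounded_bilinear_cinner: "bounded_bilinear cinner"
  by (rule bounded_bilinear.intro)
    (auto simp: cinner_simps scaleR_conv_of_real intro!: exI[of _ 1] norm_cinner_le)

interpretation cinner: bounded_bilinear cinner
  by (rule bounded_bilinear_cinner)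

lemma cinner_eqI:
  assumes "\<And>x. cinner x y = cinner x y'"
  shows "y = y'"
  using assms[of "y - y'"] by (metis cinner_diff_right cinner_self diff_self eq_iff_diff_eq_0
      norm_eq_zero of_real_eq_0_iff power2_eq_square mult_eq_0_iff)

lemma scaleC_one [simp]: "1 *\<^sub>C (x :: 'a :: complex_normed_vector) = x"
  using scaleR_scaleC[of 1 x] by simp

lemma scaleC_zero_left [simp]: "0 *\<^sub>C (x :: 'a :: complex_normed_vector) = 0"
  using scaleR_scaleC[of 0 x] by simp

lemma scaleC_minus_left: "(- a) *\<^sub>C (x :: 'a :: complex_normed_vector) = - (a *\<^sub>C x)"
  using scaleC_add_left[of a "- a" x] by (simp add: minus_unique)

interpretation scaleC: bounded_bilinear
  "(*\<^sub>C) :: complex \<Rightarrow> 'a :: complex_normed_vector \<Rightarrow> 'a"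
proof
  fix r :: real and a :: complex and x :: 'a
  show "(r *\<^sub>R a) *\<^sub>C x = r *\<^sub>R a *\<^sub>C x"
    by (simp add: scaleR_scaleC[where x = "_ :: 'a"] scaleC_scaleC scaleR_conv_of_real)
  show "a *\<^sub>C r *\<^sub>R x = r *\<^sub>R a *\<^sub>C x"
    by (simp add: scaleR_scaleC scaleC_scaleC mult.commute)
  show "\<exists>K. \<forall>a x. norm (a *\<^sub>C (x :: 'a)) \<le> norm a * norm x * K"
    by (auto simp: norm_scaleC intro!: exI[of _ 1])
qed (auto simp: scaleC_add_left scaleC_add_right)

lemma blinfun_scaleC_apply [simp]: "blinfun_apply (c *\<^sub>C T) x = c *\<^sub>C blinfun_apply T x"
  by (simp add: scaleC_blinfun.rep_eq)

lemma bopsD: "T \<in> bops \<Longrightarrow> blinfun_apply T (c *\<^sub>C x) = c *\<^sub>C blinfun_apply T x"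
  by (simp add: bops_def)

lemma bops_compose: "S \<in> bops \<Longrightarrow> T \<in> bops \<Longrightarrow> S o\<^sub>L T \<in> bops"
  by (simp add: bops_def)

lemma bops_id: "id_blinfun \<in> bops"
  by (simp add: bops_def)

lemma bops_diff: "S \<in> bops \<Longrightarrow> T \<in> bops \<Longrightarrow> S - T \<in> bops"
  by (simp add: bops_def blinfun.diff_left scaleC.diff_right)

lemma bops_minus: "S \<in> bops \<Longrightarrow> - S \<in> bops"
  by (simp add: bops_def blinfun.minus_left scaleC.minus_right)

lemma bops_add: "S \<in> bops \<Longrightarrow> T \<in> bops \<Longrightarrow> S + T \<in> bops"
  by (simp add: bops_def blinfun.add_left scaleC.add_right)

lemma bops_scaleC: "S \<in> bops \<Longrightarrow> c *\<^sub>C S \<in> bops"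
  by (simp add: bops_def scaleC_scaleC mult.commute)

lemmas bops_intros = bops_compose bops_id bops_diff bops_minus bops_add bops_scaleC

text \<open>Minimisation of \<open>\<parallel>x\<parallel>\<^sup>2 - 2 \<phi> x\<close>: by the parallelogram law a minimising sequence is Cauchy.\<close>

lemma riesz_representation:
  fixes \<phi> :: "'a :: {real_inner, complete_space} \<Rightarrow> real"
  assumes "bounded_linear \<phi>"
  obtains y where "\<And>x. \<phi> x = inner x y"
proof -
  interpret bounded_linear \<phi> by fact
  define q where "q x = (norm x)\<^sup>2 - 2 * \<phi> x" for x
  define d where "d = (INF x. q x)"
  have lower: "- (onorm \<phi>)\<^sup>2 \<le> q x" for x
  proof -
    have "\<phi> x \<le> onorm \<phi> * norm x"
      using onorm[OF assms, of x] by simp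
    moreover have "0 \<le> (norm x - onorm \<phi>)\<^sup>2" by simp
    ultimately show ?thesis
      unfolding q_def by (simp add: power2_eq_square algebra_simps)
  qed
  then have bdd: "bdd_below (range q)" by (meson bdd_belowI2)
  then have d_le: "d \<le> q x" for x
    unfolding d_def by (rule cINF_lower) simp
  have mid: "(norm (x - y))\<^sup>2 \<le> 2 * (q x - d) + 2 * (q y - d)" for x y
  proof -
    have "4 * q ((1/2) *\<^sub>R (x + y)) = (norm (x + y))\<^sup>2 - 4 * \<phi> x - 4 * \<phi> y"
      unfolding q_def by (simp add: add scaleR power_divide del: scaleR_add_right) argo
    moreover have "(norm (x + y))\<^sup>2 + (norm (x - y))\<^sup>2 = 2 * (norm x)\<^sup>2 + 2 * (norm y)\<^sup>2"
      by (simp add: power2_norm_eq_inner inner_simps)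
    ultimately show ?thesis
      using d_le[of "(1/2) *\<^sub>R (x + y)"] unfolding q_def by simp
  qed
  have "\<exists>x. q x < d + inverse (Suc n)" for n
    using cInf_lessD[of "range q" "d + inverse (Suc n)"] unfolding d_def by auto
  then obtain X where X: "\<And>n. q (X n) < d + inverse (Suc n)" by metis
  have "(\<lambda>n. q (X n)) \<longlonglongrightarrow> d"
  proof (rule tendsto_sandwich[OF _ _ tendsto_const])
    show "(\<lambda>n. d + inverse (Suc n)) \<longlonglongrightarrow> d"
      using tendsto_add[OF tendsto_const LIMSEQ_inverse_real_of_nat, of d] by simp
  qed (use X d_le in \<open>auto intro!: always_eventually less_imp_le\<close>)
  note qX = this
  have "Cauchy X"
  proof (rule metric_CauchyI)
    fix e :: real assume "e > 0"
    then have "\<forall>\<^sub>F n in sequentially. q (X n) < d + e\<^sup>2 / 4"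
      by (intro order_tendstoD(2)[OF qX]) simp
    then obtain N where N: "\<And>n. n \<ge> N \<Longrightarrow> q (X n) < d + e\<^sup>2 / 4"
      by (auto simp: eventually_sequentially)
    have "dist (X m) (X n) < e" if "m \<ge> N" "n \<ge> N" for m n
    proof -
      have "(norm (X m - X n))\<^sup>2 < e\<^sup>2"
        using mid[of "X m" "X n"] N[OF that(1)] N[OF that(2)] by argo
      then show ?thesis
        using \<open>e > 0\<close> by (simp add: dist_norm power_less_imp_less_base)
    qed
    then show "\<exists>N. \<forall>m\<ge>N. \<forall>n\<ge>N. dist (X m) (X n) < e" by blast
  qed
  then obtain y where y: "X \<longlonglongrightarrow> y"
    using Cauchy_convergent convergent_def by blast
  have "(\<lambda>n. q (X n)) \<longlonglongrightarrow> q y"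
    unfolding q_def by (intro tendsto_intros y tendsto)
  with qX have "q y = d" using LIMSEQ_unique by blast
  have "\<phi> x = inner x y" for x
  proof (rule ccontr)
    assume "\<phi> x \<noteq> inner x y"
    define a where "a = inner x y - \<phi> x"
    \<comment> \<open>Nearly the minimiser -a / |x|^2 of the quadratic in t; the added 1 keeps the
      denominator positive without a case split and still leaves a negative value.\<close>
    define t where "t = - a / ((norm x)\<^sup>2 + 1)"
    have pos: "(norm x)\<^sup>2 + 1 > 0" by (simp add: add_nonneg_pos)
    have "q (y + t *\<^sub>R x) = q y + 2 * t * a + t\<^sup>2 * (norm x)\<^sup>2"
      unfolding q_def a_def power2_norm_eq_inner
      by (simp add: inner_simps add scaleR power2_eq_square inner_commute[of y x] algebra_simps)
    then have "0 \<le> 2 * t * a + t\<^sup>2 * (norm x)\<^sup>2"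
      using d_le[of "y + t *\<^sub>R x"] \<open>q y = d\<close> by simp
    also have "\<dots> \<le> 2 * t * a + t\<^sup>2 * ((norm x)\<^sup>2 + 1)"
      by (simp add: algebra_simps)
    also have "\<dots> = - a\<^sup>2 / ((norm x)\<^sup>2 + 1)"
    proof -
      have "2 * (- a / N) * a + (- a / N)\<^sup>2 * N = - a\<^sup>2 / N" if "N > 0" for N
        using that by (simp add: field_simps power2_eq_square)
      then show ?thesis using pos unfolding t_def by blast
    qed
    also have "\<dots> < 0"
      using \<open>\<phi> x \<noteq> inner x y\<close> pos unfolding a_def by (simp add: divide_neg_pos)
    finally show False by simp
  qed
  then show ?thesis using that by blast
qed

text \<open>Definiteness of \<open>cinner\<close> makes the described operator unique, so any
  candidate satisfying the adjoint relation resolves the \<open>THE\<close>.\<close>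

lemma op_adj_eqI:
  assumes "S \<in> bops" "\<And>x y. cinner (blinfun_apply T x) y = cinner x (blinfun_apply S y)"
  shows "op_adj T = S"
  unfolding op_adj_def
proof (rule the_equality)
  fix S' assume S': "S' \<in> bops \<and> (\<forall>x y. cinner (blinfun_apply T x) y = cinner x (blinfun_apply S' y))"
  show "S' = S"
    by (rule blinfun_eqI, rule cinner_eqI) (metis S' assms(2))
qed (use assms in auto)

lemma op_adj_exists:
  fixes T :: "'a :: chilbert_space \<Rightarrow>\<^sub>L 'a"
  assumes T: "T \<in> bops"
  shows "op_adj T \<in> bops \<and> cinner (blinfun_apply T x) y = cinner x (blinfun_apply (op_adj T) y)"
proof -
  have "\<exists>w. \<forall>x. inner (blinfun_apply T x) y = inner x w" for y
  proof -
    have "bounded_linear (\<lambda>x. inner (blinfun_apply T x) y)"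
      by (intro bounded_linear_intros)
    then show ?thesis by (rule riesz_representation) blast
  qed
  then obtain S where S: "\<And>x y. inner (blinfun_apply T x) y = inner x (S y)" by metis
  \<comment> \<open>Riesz is applied to the real inner product only. The imaginary part is the real
    form at \<open>\<i> *\<^sub>C x\<close>, and it is here that \<open>T\<close> must commute with
    \<open>\<i>\<close>.\<close>
  have CS: "cinner (blinfun_apply T x) y = cinner x (S y)" for x y
    by (rule complex_eqI)
      (simp_all add: inner_eq_Re_cinner[symmetric] Im_cinner bopsD[OF T, symmetric] S)
  have bound: "norm (S y) \<le> norm y * norm T" for y
  proof (cases "S y = 0")
    case False
    have "norm (S y) * norm (S y) = inner (blinfun_apply T (S y)) y"
      by (simp add: S norm_eq_sqrt_inner)
    also have "\<dots> \<le> norm (blinfun_apply T (S y)) * norm y"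
      by (rule norm_cauchy_schwarz)
    also have "\<dots> \<le> norm T * norm (S y) * norm y"
      by (intro mult_right_mono norm_blinfun) simp
    finally show ?thesis using False by (simp add: mult.commute mult.left_commute)
  qed simp
  have bl: "bounded_linear S"
  proof (rule bounded_linear_intro[OF _ _ bound])
    show "S (x + y) = S x + S y" for x y
      by (rule cinner_eqI) (simp add: CS[symmetric] cinner_simps)
    show "S (r *\<^sub>R x) = r *\<^sub>R S x" for r x
      by (rule cinner_eqI) (simp add: CS[symmetric] cinner_simps)
  qed
  have scale: "S (c *\<^sub>C x) = c *\<^sub>C S x" for c x
    by (rule cinner_eqI) (simp add: CS[symmetric] cinner_simps)
  have "op_adj T = Blinfun S"
    by (rule op_adj_eqI) (simp_all add: bops_def bounded_linear_Blinfun_apply bl scale CS)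
  then show ?thesis
    by (simp add: bops_def bounded_linear_Blinfun_apply bl scale CS)
qed

lemma op_adj_in_bops: "T \<in> bops \<Longrightarrow> op_adj T \<in> bops"
  using op_adj_exists by blast

lemma cinner_op_adj: "T \<in> bops \<Longrightarrow> cinner (blinfun_apply T x) y = cinner x (blinfun_apply (op_adj T) y)"
  using op_adj_exists by blast

lemma cinner_op_adj_left: "T \<in> bops \<Longrightarrow> cinner (blinfun_apply (op_adj T) x) y = cinner x (blinfun_apply T y)"
  by (metis cinner_commute cinner_op_adj)

lemma cinner_op_Im:
  assumes "T \<in> bops"
  shows "cinner (blinfun_apply (op_Im T) f) f = complex_of_real (Im (cinner (blinfun_apply T f) f))"
proof -
  have "cinner (blinfun_apply (op_adj T) f) f = cnj (cinner (blinfun_apply T f) f)"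
    using cinner_op_adj_left[OF assms] cinner_commute by metis
  then show ?thesis
    by (simp add: op_Im_def cinner_simps blinfun.diff_left complex_eq_iff)
qed

section \<open>Means over the unit circle\<close>

text \<open>Normalised to mass 1 on [0,1], matching \<open>circlepath\<close>. A relation, as for
  \<open>has_integral\<close>, carries existence along with the value through all linear
  combinations.\<close>

definition has_circle_mean :: "(complex \<Rightarrow> complex) \<Rightarrow> complex \<Rightarrow> bool"
  where "has_circle_mean \<phi> I \<longleftrightarrow> ((\<lambda>t. \<phi> (cis (2 * pi * t))) has_integral I) {0..1}"

lemma has_circle_mean_cong:
  assumes "has_circle_mean \<phi> I" "\<And>u. cmod u = 1 \<Longrightarrow> \<psi> u = \<phi> u" "I = J"
  shows "has_circle_mean \<psi> J"
  using assms unfolding has_circle_mean_def by simp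

lemma has_circle_mean_add:
  "has_circle_mean \<phi> I \<Longrightarrow> has_circle_mean \<psi> J \<Longrightarrow> has_circle_mean (\<lambda>u. \<phi> u + \<psi> u) (I + J)"
  unfolding has_circle_mean_def by (rule has_integral_add)

lemma has_circle_mean_diff:
  "has_circle_mean \<phi> I \<Longrightarrow> has_circle_mean \<psi> J \<Longrightarrow> has_circle_mean (\<lambda>u. \<phi> u - \<psi> u) (I - J)"
  unfolding has_circle_mean_def by (rule has_integral_diff)

lemma has_circle_mean_cmult:
  "has_circle_mean \<phi> I \<Longrightarrow> has_circle_mean (\<lambda>u. c * \<phi> u) (c * I)"
  unfolding has_circle_mean_def by (rule has_integral_mult_right)

lemma has_circle_mean_sum:
  assumes "finite A" "\<And>a. a \<in> A \<Longrightarrow> has_circle_mean (\<phi> a) (I a)"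
  shows "has_circle_mean (\<lambda>u. \<Sum>a\<in>A. \<phi> a u) (\<Sum>a\<in>A. I a)"
  using assms unfolding has_circle_mean_def by (rule has_integral_sum)

lemma has_circle_mean_nonneg:
  assumes "has_circle_mean \<phi> I" "\<And>u. cmod u = 1 \<Longrightarrow> \<phi> u \<in> \<real>\<^sub>\<ge>\<^sub>0"
  shows "I \<in> \<real>\<^sub>\<ge>\<^sub>0"
proof -
  have int: "((\<lambda>t. \<phi> (cis (2 * pi * t))) has_integral I) {0..1}"
    using assms(1) unfolding has_circle_mean_def .
  have "0 \<le> Re I"
    using has_integral_linear[OF int bounded_linear_Re] assms(2)
    by (auto simp: o_def complex_nonneg_Reals_iff intro: has_integral_nonneg)
  moreover have "((\<lambda>t. Im (\<phi> (cis (2 * pi * t)))) has_integral Im I) {0..1}"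
    using has_integral_linear[OF int bounded_linear_Im] by (simp add: o_def)
  then have "Im I = 0"
    using assms(2) by (simp add: complex_nonneg_Reals_iff)
  ultimately show ?thesis by (simp add: complex_nonneg_Reals_iff)
qed

text \<open>Conjugation is t -> -t, which moves the interval to [-1,0]; the period 1 of
  \<open>cis (2 * pi * t)\<close> moves it back.\<close>

lemma has_circle_mean_cnj:
  assumes "has_circle_mean \<phi> I"
  shows "has_circle_mean (\<lambda>u. \<phi> (cnj u)) I"
proof -
  have "((\<lambda>t. \<phi> (cis (2 * pi * (- t)))) has_integral I) {-1..-0}"
    using assms unfolding has_circle_mean_def by (intro has_integral_reflect_lemma_real)
  then have "((\<lambda>t. \<phi> (cis (2 * pi * (- t)))) \<circ> (+) (- 1) has_integral I) {0..1}"
    by (subst has_integral_shift_Icc_real) simp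
  moreover have "cis (2 * pi * (- (- 1 + t))) = cnj (cis (2 * pi * t))" for t
    by (simp add: complex_eq_iff cos_diff sin_diff algebra_simps)
  ultimately show ?thesis
    unfolding has_circle_mean_def o_def by simp
qed

lemma has_circle_mean_Cauchy:
  assumes p: "p holomorphic_on cball 0 1" and v: "cmod v < 1"
  shows "has_circle_mean (\<lambda>u. p u * u / (u - v)) (p v)"
proof -
  have cis: "cis (2 * pi * t) = exp (2 * of_real pi * \<i> * of_real t)" for t
    by (simp add: cis_conv_exp mult_ac)
  have "((\<lambda>u. p u / (u - v)) has_contour_integral (2 * of_real pi * \<i> * p v)) (circlepath 0 1)"
    using Cauchy_integral_circlepath_simple[OF p, of v] v by simp
  then have "((\<lambda>t. p (circlepath 0 1 t) / (circlepath 0 1 t - v) *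
      vector_derivative (circlepath 0 1) (at t within {0..1})) has_integral
      2 * of_real pi * \<i> * p v) {0..1}"
    unfolding has_contour_integral_def .
  then have "((\<lambda>t. (2 * of_real pi * \<i>) * (p (cis (2 * pi * t)) * cis (2 * pi * t) /
      (cis (2 * pi * t) - v))) has_integral (2 * of_real pi * \<i>) * p v) {0..1}"
  proof (rule has_integral_eq[rotated])
    fix t :: real assume "t \<in> {0..1}"
    then have "vector_derivative (circlepath 0 1) (at t within {0..1}) =
        2 * pi * \<i> * cis (2 * pi * t)"
      by (simp add: vector_derivative_circlepath01 cis)
    then show "p (circlepath 0 1 t) / (circlepath 0 1 t - v) *
        vector_derivative (circlepath 0 1) (at t within {0..1}) =
        (2 * of_real pi * \<i>) * (p (cis (2 * pi * t)) * cis (2 * pi * t) / (cis (2 * pi * t) - v))"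
      by (simp add: circlepath cis)
  qed
  then show ?thesis
    unfolding has_circle_mean_def
    by (subst (asm) has_integral_mult_right_iff) auto
qed

text \<open>For \<open>p u = \<langle>T u x, x\<rangle>\<close> with \<open>T (cnj u) = (T u)\<^sup>*\<close> this is \<open>Im u * Im \<langle>T u x, x\<rangle>\<close>.\<close>

definition boundary_form :: "(complex \<Rightarrow> complex) \<Rightarrow> complex \<Rightarrow> complex"
  where "boundary_form p u = complex_of_real (Im u) * (p u - p (cnj u)) / (2 * \<i>)"

definition joukowski :: "complex \<Rightarrow> complex"
  where "joukowski v = 2 * v / (1 + v\<^sup>2)"

text \<open>In terms of \<open>z = joukowski v\<close> and \<open>c = Re u\<close> this is \<open>z / (1 - c z)\<close>.\<close>

definition resolvent_kernel :: "complex \<Rightarrow> complex \<Rightarrow> complex"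
  where "resolvent_kernel v u = 2 * v / (1 + v\<^sup>2 - 2 * v * complex_of_real (Re u))"

lemma one_minus_mult_nonzero: "cmod u = 1 \<Longrightarrow> cmod v < 1 \<Longrightarrow> 1 - v * u \<noteq> 0"
  by (metis eq_iff_diff_eq_0 less_irrefl mult.right_neutral norm_mult norm_one)

lemma resolvent_denominator:
  assumes u: "cmod u = 1"
  shows "1 + v\<^sup>2 - 2 * v * complex_of_real (Re u) = (1 - v * u) * (1 - v * cnj u)"
proof -
  have "2 * complex_of_real (Re u) = u + cnj u"
    by (simp add: complex_add_cnj)
  moreover have "u * cnj u = 1"
    using u by (simp add: complex_norm_square[symmetric])
  ultimately show ?thesis by algebra
qed

lemma resolvent_denominator_nonzero:
  assumes "cmod u = 1" "cmod v < 1"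
  shows "1 + v\<^sup>2 - 2 * v * complex_of_real (Re u) \<noteq> 0"
  using one_minus_mult_nonzero[of u v] one_minus_mult_nonzero[of "cnj u" v] assms
  by (simp add: resolvent_denominator)

text \<open>The kernel arising from Cauchy's formula at \<open>v\<close> and at \<open>0\<close> is odd under \<open>u \<mapsto> cnj u\<close>,
  so the mean only sees the odd part of \<open>p\<close>.\<close>

lemma has_circle_mean_boundary_form:
  assumes p: "p holomorphic_on cball 0 1" and v: "cmod v < 1"
  shows "has_circle_mean (\<lambda>u. resolvent_kernel v u * boundary_form p u) (p v - p 0)"
proof -
  have nz: "1 - u * v \<noteq> 0" if "u \<in> cball 0 1" for u
  proof -
    have "cmod (u * v) < 1"
      using that v mult_mono[of "cmod u" 1 "cmod v" "cmod v"] by (simp add: norm_mult)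
    then show ?thesis by (metis eq_iff_diff_eq_0 less_irrefl norm_one)
  qed
  \<comment> \<open>On the circle the Cauchy kernel \<open>u / (u - v)\<close> equals
    \<open>1 / (1 - v * cnj u)\<close>; subtracting its mirror image \<open>1 / (1 - u * v)\<close>
    makes it odd. The pole of the correction lies outside the closed disc, and its mean against
    \<open>p\<close> is the value at 0 of the quotient, that is \<open>p 0\<close>.\<close>
  have "(\<lambda>u. p u / (1 - u * v)) holomorphic_on cball 0 1"
    using nz by (intro holomorphic_intros p) auto
  from has_circle_mean_diff[OF has_circle_mean_Cauchy[OF p v] has_circle_mean_Cauchy[OF this, of 0]]
  have D: "has_circle_mean (\<lambda>u. p u * u / (u - v) - p u / (1 - u * v) * u / (u - 0)) (p v - p 0)"
    by simp
  \<comment> \<open>Averaging with the reflected identity replaces \<open>p u\<close> by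
    \<open>(p u - p (cnj u)) / 2\<close>, because the kernel is odd.\<close>
  have even: "has_circle_mean (\<lambda>u. (1/2) * ((p u * u / (u - v) - p u / (1 - u * v) * u / (u - 0)) +
      (p (cnj u) * cnj u / (cnj u - v) - p (cnj u) / (1 - cnj u * v) * cnj u / (cnj u - 0))))
      ((1/2) * ((p v - p 0) + (p v - p 0)))"
    by (rule has_circle_mean_cmult[OF has_circle_mean_add[OF D has_circle_mean_cnj[OF D]]])
  have k: "q * u / (u - v) - q / (1 - u * v) * u / (u - 0) =
      q * (v * (cnj u - u) / ((1 - v * u) * (1 - v * cnj u)))" if u: "cmod u = 1" for q u
  proof -
    have uc: "u * cnj u = 1"
      using u by (simp add: complex_norm_square[symmetric])
    have "u \<noteq> 0" "u \<noteq> v" using u v by auto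
    moreover have "1 - v * u \<noteq> 0" "1 - v * cnj u \<noteq> 0"
      using u v one_minus_mult_nonzero[of u v] one_minus_mult_nonzero[of "cnj u" v] by auto
    moreover have cu: "cnj u = 1 / u" using uc \<open>u \<noteq> 0\<close> by (simp add: field_simps)
    ultimately show ?thesis
      unfolding cu by (simp add: divide_simps) (simp add: algebra_simps power2_eq_square)
  qed
  show ?thesis
  proof (rule has_circle_mean_cong[OF even])
    fix u :: complex assume u: "cmod u = 1"
    have nzu: "1 - v * u \<noteq> 0" "1 - v * cnj u \<noteq> 0"
      using u v one_minus_mult_nonzero[of u v] one_minus_mult_nonzero[of "cnj u" v] by auto
    have im: "complex_of_real (Im u) = (u - cnj u) / (2 * \<i>)"
      by (simp add: complex_eq_iff)
    show "resolvent_kernel v u * boundary_form p u = (1/2) *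
      ((p u * u / (u - v) - p u / (1 - u * v) * u / (u - 0)) +
      (p (cnj u) * cnj u / (cnj u - v) - p (cnj u) / (1 - cnj u * v) * cnj u / (cnj u - 0)))"
      unfolding k[OF u] k[of "cnj u", unfolded complex_mod_cnj, OF u] complex_cnj_cnj
        resolvent_kernel_def boundary_form_def resolvent_denominator[OF u] im
      using nzu by (simp add: divide_simps) (simp add: algebra_simps)
  qed simp
qed

section \<open>The kernel of a symmetric dissipative family on the disc\<close>

lemma one_plus_square_nonzero: "cmod v < 1 \<Longrightarrow> 1 + v\<^sup>2 \<noteq> 0"
  by (metis abs_norm_cancel add_eq_0_iff2 norm_minus_cancel norm_one norm_power
      power_less_one_iff less_irrefl norm_ge_zero pos2 power_eq_1_iff)

lemma joukowski_resolvent: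
  assumes "cmod u = 1" "cmod v < 1"
  shows "1 - joukowski v * complex_of_real (Re u) \<noteq> 0"
    and "resolvent_kernel v u = joukowski v / (1 - joukowski v * complex_of_real (Re u))"
proof -
  define q c where "q = 1 + v\<^sup>2" and "c = complex_of_real (Re u)"
  have q: "q \<noteq> 0" "q - 2 * v * c \<noteq> 0"
    unfolding q_def c_def
    using resolvent_denominator_nonzero[OF assms] one_plus_square_nonzero[OF assms(2)] by auto
  have eq: "1 - joukowski v * c = (q - 2 * v * c) / q"
    using q by (simp add: joukowski_def q_def[symmetric] field_simps)
  show "1 - joukowski v * c \<noteq> 0"
    using q unfolding eq by simp
  show "resolvent_kernel v u = joukowski v / (1 - joukowski v * c)"
    using q unfolding eq by (simp add: resolvent_kernel_def joukowski_def q_def c_def)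
qed

lemma joukowski_cnj: "joukowski (cnj v) = cnj (joukowski v)"
  by (simp add: joukowski_def)

lemma joukowski_minus: "joukowski (- v) = - joukowski v"
  by (simp add: joukowski_def)

lemma joukowski_of_real: "joukowski (complex_of_real r) = complex_of_real (2 * r / (1 + r\<^sup>2))"
  by (simp add: joukowski_def)

lemma joukowski_real_bounds:
  fixes r :: real
  assumes "0 < r" "r < 1"
  shows "0 < 2 * r / (1 + r\<^sup>2)" "2 * r / (1 + r\<^sup>2) < 1"
proof -
  have "0 < (1 - r)\<^sup>2" using assms by simp
  then show "2 * r / (1 + r\<^sup>2) < 1"
    by (simp add: divide_simps power2_eq_square algebra_simps add_pos_nonneg)
qed (use assms in \<open>auto intro!: divide_pos_pos add_pos_nonneg\<close>)

text \<open>Model case: \<open>T u = \<Omega> (joukowski (r * u))\<close> with \<open>0 < r < 1\<close> and \<open>\<Omega>\<close> in the class \<open>RS\<close>.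
  In the formulas below \<open>s = joukowski \<rho>\<close>, so that the spectral variable \<open>s * Re u\<close> stays
  away from \<open>\<plusminus>1\<close> and all integrands are continuous.\<close>

locale disc_family =
  fixes T :: "complex \<Rightarrow> ('a :: chilbert_space \<Rightarrow>\<^sub>L 'a)" and \<rho> :: real
  assumes bops: "\<And>u. cmod u \<le> 1 \<Longrightarrow> T u \<in> bops"
    and holomorphic: "\<And>x y. (\<lambda>u. cinner (T u x) y) holomorphic_on cball 0 1"
    and symmetric: "\<And>u x y. cmod u \<le> 1 \<Longrightarrow> cinner (T u x) y = cinner x (T (cnj u) y)"
    and dissipative: "\<And>u x. cmod u = 1 \<Longrightarrow> 0 \<le> Im u * Im (cinner (T u x) x)"
    and rho: "0 < \<rho>" "\<rho> < 1"
    and lower: "\<And>x. cinner x x + cinner (T (- complex_of_real \<rho>) x) x \<in> \<real>\<^sub>\<ge>\<^sub>0"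
    and upper: "\<And>x. cinner x x - cinner (T (complex_of_real \<rho>) x) x \<in> \<real>\<^sub>\<ge>\<^sub>0"
begin

section \<open>Scalar algebra of the Blaschke factors on the circle\<close>

abbreviation coeff :: "'a \<Rightarrow> 'a \<Rightarrow> complex \<Rightarrow> complex"
  where "coeff x y u \<equiv> cinner (T u x) y"

definition s :: real
  where "s = 2 * \<rho> / (1 + \<rho>\<^sup>2)"

text \<open>Half the difference of the resolvent kernels at \<rho> and -\<rho>
  (\<open>weight_eq\<close>): nonnegative on the circle, and with a mean against the boundary form
  that is explicit in \<open>T\<close>.\<close>

definition weight :: "complex \<Rightarrow> real"
  where "weight u = s / (1 - s\<^sup>2 * (Re u)\<^sup>2)"

text \<open>With z = \<open>joukowski v\<close> and t = s * Re u this is b_t(z / s) = (z/s - t) / (1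
  - t z/s), cleared of inner fractions.\<close>

definition beta :: "complex \<Rightarrow> complex \<Rightarrow> complex"
  where "beta v u = (joukowski v - s\<^sup>2 * Re u) / (s * (1 - joukowski v * Re u))"

lemma s_bounds: "0 < s" "s < 1"
  using joukowski_real_bounds[OF rho] by (auto simp: s_def)

lemma cmod_rho: "cmod (complex_of_real \<rho>) < 1" "cmod (- complex_of_real \<rho>) < 1"
  using rho by auto

lemma joukowski_rho: "joukowski \<rho> = s" "joukowski (- complex_of_real \<rho>) = - s"
  by (simp_all add: s_def joukowski_of_real joukowski_minus)

lemma s_Re_bounds:
  assumes "cmod u = 1"
  shows "s\<^sup>2 * (Re u)\<^sup>2 < 1" "\<bar>s * Re u\<bar> < 1"
proof -
  have "\<bar>Re u\<bar> \<le> 1" using abs_Re_le_cmod[of u] assms by simp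
  then have "s * \<bar>Re u\<bar> \<le> s * 1" using s_bounds by (intro mult_left_mono) auto
  then have "s * \<bar>Re u\<bar> < 1" using s_bounds by linarith
  then show "\<bar>s * Re u\<bar> < 1" using s_bounds by (simp add: abs_mult)
  then show "s\<^sup>2 * (Re u)\<^sup>2 < 1"
    by (simp add: power_mult_distrib[symmetric] abs_square_less_1)
qed

lemma weight_nonneg: "cmod u = 1 \<Longrightarrow> 0 \<le> weight u"
  using s_Re_bounds[of u] s_bounds by (simp add: weight_def)

lemma weight_eq:
  assumes u: "cmod u = 1"
  shows "weight u = (resolvent_kernel \<rho> u - resolvent_kernel (- complex_of_real \<rho>) u) / 2"
proof -
  have "1 - s * Re u \<noteq> 0" "1 + s * Re u \<noteq> 0" "1 - s\<^sup>2 * (Re u)\<^sup>2 \<noteq> 0"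
    using s_Re_bounds[OF u] by auto
  then have "weight u = (s / (1 - s * Re u) + s / (1 + s * Re u)) / 2"
    unfolding weight_def by (simp add: divide_simps) (simp add: algebra_simps power2_eq_square)
  from arg_cong[OF this, of complex_of_real] show ?thesis
    unfolding joukowski_resolvent(2)[OF u cmod_rho(1)] joukowski_resolvent(2)[OF u cmod_rho(2)]
      joukowski_rho by simp
qed

text \<open>Partial fractions in c = Re u: the pole 1/z gives the resolvent kernel at v. At the
  poles 1/s and -1/s of \<open>weight\<close> the factor \<open>beta\<close> is generically -1 and
  1, which turns half the difference of the kernels into minus half their sum.\<close>

lemma beta_weight_eq:
  assumes u: "cmod u = 1" and v: "cmod v < 1"
  shows "beta v u * complex_of_real (weight u) =
    resolvent_kernel v u - (resolvent_kernel \<rho> u + resolvent_kernel (- complex_of_real \<rho>) u) / 2"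
proof -
  define c S z N where "c = complex_of_real (Re u)" and "S = complex_of_real s"
    and "z = joukowski v" and "N = 1 - S\<^sup>2 * c\<^sup>2"
  have N: "N = complex_of_real (1 - s\<^sup>2 * (Re u)\<^sup>2)" "N = (1 - S * c) * (1 + S * c)"
    by (simp_all add: N_def S_def c_def algebra_simps power2_eq_square)
  have "N \<noteq> 0"
    unfolding N(1) of_real_eq_0_iff using s_Re_bounds[OF u] by simp
  then have nz: "1 - S * c \<noteq> 0" "1 + S * c \<noteq> 0" "N \<noteq> 0"
    using N(2) by auto
  have nzz: "1 - z * c \<noteq> 0" "S \<noteq> 0"
    using joukowski_resolvent(1)[OF u v] s_bounds by (auto simp: z_def c_def S_def)
  have "(S / (1 - S * c) + (- S) / (1 + S * c)) / 2 = S\<^sup>2 * c / N"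
    unfolding N(2) using nz by (simp add: divide_simps) (simp add: algebra_simps power2_eq_square)
  moreover have "z / (1 - z * c) - S\<^sup>2 * c / N = (z - S\<^sup>2 * c) / (1 - z * c) / N"
    using nz nzz by (simp add: divide_simps) (simp add: N_def algebra_simps power2_eq_square)
  moreover have "\<dots> = beta v u * complex_of_real (weight u)"
    using nzz by (simp add: beta_def weight_def N_def z_def c_def S_def)
  ultimately show ?thesis
    unfolding joukowski_resolvent(2)[OF u cmod_rho(1)] joukowski_resolvent(2)[OF u cmod_rho(2)]
      joukowski_resolvent(2)[OF u v] joukowski_rho by (simp add: z_def c_def S_def)
qed

text \<open>The vanishing of the scalar kernel, rescaled by s and with a free second point in place
  of a conjugate. It linearises products of Blaschke factors, so second moments follow from the
  zeroth and first ones without a new integral.\<close>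

lemma beta_mult:
  assumes u: "cmod u = 1" and v: "cmod v < 1" and w: "cmod w < 1"
    and ne: "joukowski v \<noteq> joukowski w"
  shows "beta v u * beta w u = 1 - ((complex_of_real s)\<^sup>2 - joukowski w * joukowski v) /
    (complex_of_real s * (joukowski v - joukowski w)) * (beta v u - beta w u)"
proof -
  define c S z y where "c = complex_of_real (Re u)" and "S = complex_of_real s"
    and "z = joukowski v" and "y = joukowski w"
  have beta: "beta v u = (z - S\<^sup>2 * c) / (S * (1 - z * c))"
    "beta w u = (y - S\<^sup>2 * c) / (S * (1 - y * c))"
    by (simp_all add: beta_def c_def S_def z_def y_def)
  have nz: "1 - z * c \<noteq> 0" "1 - y * c \<noteq> 0" "S \<noteq> 0" "z - y \<noteq> 0"
    using joukowski_resolvent(1)[OF u v] joukowski_resolvent(1)[OF u w] s_bounds ne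
    by (auto simp: c_def S_def z_def y_def)
  have diff: "beta v u - beta w u = (z - y) * (1 - S\<^sup>2 * c\<^sup>2) / (S * (1 - z * c) * (1 - y * c))"
    unfolding beta using nz
    by (simp add: divide_simps) (simp add: algebra_simps power2_eq_square)
  have "beta v u * beta w u = 1 - (S\<^sup>2 - y * z) / (S * (z - y)) * (beta v u - beta w u)"
    unfolding diff unfolding beta using nz
    by (simp add: divide_simps) (simp add: algebra_simps power2_eq_square)
  then show ?thesis by (simp only: S_def z_def y_def)
qed

lemma beta_cnj: "beta (cnj v) u = cnj (beta v u)"
  by (simp add: beta_def joukowski_cnj)

section \<open>Moments of the operator density of orders zero, one and two\<close>

lemma mean_weight:
  "has_circle_mean (\<lambda>u. complex_of_real (weight u) * boundary_form (coeff x y) u)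
    ((coeff x y (complex_of_real \<rho>) - coeff x y (- complex_of_real \<rho>)) / 2)"
proof (rule has_circle_mean_cong[OF has_circle_mean_cmult[where c = "1/2",
      OF has_circle_mean_diff[OF has_circle_mean_boundary_form[OF holomorphic[of x y] cmod_rho(1)]
        has_circle_mean_boundary_form[OF holomorphic[of x y] cmod_rho(2)]]]])
  fix u :: complex assume "cmod u = 1"
  then show "complex_of_real (weight u) * boundary_form (coeff x y) u =
      1 / 2 * (resolvent_kernel \<rho> u * boundary_form (coeff x y) u -
        resolvent_kernel (- complex_of_real \<rho>) u * boundary_form (coeff x y) u)"
    by (simp only: weight_eq) (simp add: field_simps)
qed simp

text \<open>Point masses (I + T(-\<rho>)) / 2 at \<open>beta\<close> = 1 and (I - T(\<rho>)) / 2 at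
  \<open>beta\<close> = -1 add exactly (T(\<rho>) + T(-\<rho>)) / 2 to this mean, so the completed
  first moment is T(v). They likewise complete the mass in \<open>mean_weight\<close> to I.\<close>

lemma mean_beta:
  assumes v: "cmod v < 1"
  shows "has_circle_mean (\<lambda>u. beta v u * complex_of_real (weight u) * boundary_form (coeff x y) u)
    (coeff x y v - (coeff x y (complex_of_real \<rho>) + coeff x y (- complex_of_real \<rho>)) / 2)"
proof (rule has_circle_mean_cong[OF has_circle_mean_diff[OF
      has_circle_mean_boundary_form[OF holomorphic[of x y] v] has_circle_mean_cmult[where c = "1/2",
      OF has_circle_mean_add[OF has_circle_mean_boundary_form[OF holomorphic[of x y] cmod_rho(1)]
        has_circle_mean_boundary_form[OF holomorphic[of x y] cmod_rho(2)]]]]])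
  fix u :: complex assume u: "cmod u = 1"
  show "beta v u * complex_of_real (weight u) * boundary_form (coeff x y) u =
      resolvent_kernel v u * boundary_form (coeff x y) u -
      1 / 2 * (resolvent_kernel \<rho> u * boundary_form (coeff x y) u +
        resolvent_kernel (- complex_of_real \<rho>) u * boundary_form (coeff x y) u)"
    by (simp only: beta_weight_eq[OF u v]) (simp add: field_simps)
qed (simp add: field_simps)

lemma mean_beta_beta:
  assumes v: "cmod v < 1" and w: "cmod w < 1" and ne: "joukowski v \<noteq> joukowski w"
  shows "has_circle_mean
    (\<lambda>u. beta v u * beta w u * complex_of_real (weight u) * boundary_form (coeff x y) u)
    ((coeff x y (complex_of_real \<rho>) - coeff x y (- complex_of_real \<rho>)) / 2 -
      ((complex_of_real s)\<^sup>2 - joukowski w * joukowski v) /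
      (complex_of_real s * (joukowski v - joukowski w)) * (coeff x y v - coeff x y w))"
    (is "has_circle_mean _ (_ - ?C * _)")
proof (rule has_circle_mean_cong[OF has_circle_mean_diff[OF mean_weight[of x y]
      has_circle_mean_cmult[where c = ?C, OF has_circle_mean_diff[OF mean_beta[OF v, of x y]
        mean_beta[OF w, of x y]]]]])
  fix u :: complex assume u: "cmod u = 1"
  show "beta v u * beta w u * complex_of_real (weight u) * boundary_form (coeff x y) u =
      complex_of_real (weight u) * boundary_form (coeff x y) u -
      ?C * (beta v u * complex_of_real (weight u) * boundary_form (coeff x y) u -
        beta w u * complex_of_real (weight u) * boundary_form (coeff x y) u)"
    unfolding beta_mult[OF u v w ne] by (simp only: left_diff_distrib right_diff_distrib mult_ac mult_1)
qed simp

section \<open>The density as a sesquilinear form, and the kernel as its variance\<close>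

abbreviation bform :: "complex \<Rightarrow> 'a \<Rightarrow> 'a \<Rightarrow> complex"
  where "bform u x y \<equiv> boundary_form (coeff x y) u"

lemma bform_diff_left: "bform u (x - x') y = bform u x y - bform u x' y"
  by (simp add: boundary_form_def cinner_simps blinfun.diff_right field_simps)

lemma bform_diff_right: "bform u x (y - y') = bform u x y - bform u x y'"
  by (simp add: boundary_form_def cinner_simps field_simps)

lemma bform_scaleC_left: "cmod u \<le> 1 \<Longrightarrow> bform u (a *\<^sub>C x) y = a * bform u x y"
  by (simp add: boundary_form_def cinner_simps bopsD[OF bops] algebra_simps)

lemma bform_scaleC_right: "bform u x (a *\<^sub>C y) = cnj a * bform u x y"
  by (simp add: boundary_form_def cinner_simps algebra_simps)

lemma bform_sum_left: "bform u (\<Sum>i\<in>A. x i) y = (\<Sum>i\<in>A. bform u (x i) y)"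
  by (simp add: boundary_form_def blinfun.sum_right cinner.sum_left sum_distrib_left
      sum_divide_distrib sum_negf flip: sum_subtractf)

lemma bform_sum_right: "bform u x (\<Sum>i\<in>A. y i) = (\<Sum>i\<in>A. bform u x (y i))"
  by (simp add: boundary_form_def cinner.sum_right sum_distrib_left
      sum_divide_distrib sum_negf flip: sum_subtractf)

lemma bform_nonneg:
  assumes u: "cmod u = 1"
  shows "bform u x x \<in> \<real>\<^sub>\<ge>\<^sub>0"
proof -
  have "coeff x x (cnj u) = cnj (coeff x x u)"
    using u symmetric[of "cnj u" x x] cinner_commute by (metis complex_cnj_cnj complex_mod_cnj order_refl)
  then have "bform u x x = complex_of_real (Im u * Im (coeff x x u))"
    by (simp add: boundary_form_def complex_eq_iff)
  then show ?thesis
    using dissipative[OF u, of x] by (simp add: complex_nonneg_Reals_iff)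
qed

text \<open>Sesquilinear expansion gives moments of orders two, one, one and zero;
  \<open>cnj (beta w u)\<close> is \<open>beta (cnj w) u\<close>, so the second moment is taken at v
  and cnj w. The two subtracted terms are the contributions of the point masses, where the vector
  \<open>beta v u *\<^sub>C x - T v x\<close> becomes x - T v x or -(x + T v x).\<close>

lemma pair_mean:
  assumes v: "cmod v < 1" and w: "cmod w < 1" and ne: "joukowski v \<noteq> cnj (joukowski w)"
  shows "has_circle_mean
    (\<lambda>u. complex_of_real (weight u) * bform u (beta v u *\<^sub>C x - T v x) (beta w u *\<^sub>C y - T w y))
    ((cinner x y - ((complex_of_real s)\<^sup>2 - cnj (joukowski w) * joukowski v) /
        (complex_of_real s * (joukowski v - cnj (joukowski w))) * (coeff x y v - coeff x y (cnj w))
        - cinner (T v x) (T w y))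
      - (cinner (x - T v x) (y - T w y) + coeff (x - T v x) (y - T w y) (- complex_of_real \<rho>)) / 2
      - (cinner (x + T v x) (y + T w y) - coeff (x + T v x) (y + T w y) (complex_of_real \<rho>)) / 2)"
proof -
  have w': "cmod (cnj w) < 1" and ne': "joukowski v \<noteq> joukowski (cnj w)"
    using w ne by (auto simp: joukowski_cnj)
  have sym: "coeff (T v x) y (cnj w) = cinner (T v x) (T w y)"
    using w symmetric[of "cnj w"] by simp
  note mean = has_circle_mean_add[OF has_circle_mean_diff[OF has_circle_mean_diff[OF
      mean_beta_beta[OF v w' ne', of x y] mean_beta[OF v, of x "T w y"]]
      mean_beta[OF w', of "T v x" y]] mean_weight[of "T v x" "T w y"]]
  show ?thesis
  proof (rule has_circle_mean_cong[OF mean])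
    fix u :: complex assume u: "cmod u = 1"
    then have u1: "cmod u \<le> 1" by simp
    show "complex_of_real (weight u) * bform u (beta v u *\<^sub>C x - T v x) (beta w u *\<^sub>C y - T w y) =
      beta v u * beta (cnj w) u * complex_of_real (weight u) * bform u x y -
      beta v u * complex_of_real (weight u) * bform u x (T w y) - beta (cnj w) u * complex_of_real (weight u) * bform u (T v x) y +
      complex_of_real (weight u) * bform u (T v x) (T w y)"
      unfolding bform_diff_left bform_diff_right bform_scaleC_left[OF u1] bform_scaleC_right beta_cnj
      by (simp add: algebra_simps)
  next
    show "(coeff x y (complex_of_real \<rho>) - coeff x y (- complex_of_real \<rho>)) / 2 - ((complex_of_real s)\<^sup>2 - joukowski (cnj w) * joukowski v) /
        (complex_of_real s * (joukowski v - joukowski (cnj w))) * (coeff x y v - coeff x y (cnj w)) -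
        (coeff x (T w y) v - (coeff x (T w y) (complex_of_real \<rho>) + coeff x (T w y) (- complex_of_real \<rho>)) / 2) -
        (coeff (T v x) y (cnj w) - (coeff (T v x) y (complex_of_real \<rho>) + coeff (T v x) y (- complex_of_real \<rho>)) / 2) +
        (coeff (T v x) (T w y) (complex_of_real \<rho>) - coeff (T v x) (T w y) (- complex_of_real \<rho>)) / 2 =
      (cinner x y - ((complex_of_real s)\<^sup>2 - cnj (joukowski w) * joukowski v) /
        (complex_of_real s * (joukowski v - cnj (joukowski w))) * (coeff x y v - coeff x y (cnj w))
        - cinner (T v x) (T w y))
      - (cinner (x - T v x) (y - T w y) + coeff (x - T v x) (y - T w y) (- complex_of_real \<rho>)) / 2
      - (cinner (x + T v x) (y + T w y) - coeff (x + T v x) (y + T w y) (complex_of_real \<rho>)) / 2"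
      unfolding sym joukowski_cnj
      by (simp add: cinner_simps blinfun.diff_right blinfun.add_right field_simps)
  qed
qed

text \<open>With \<open>P\<^sub>- = I + T (-\<rho>)\<close> and \<open>P\<^sub>+ = I - T \<rho>\<close>, the kernel is the mean of the nonnegative form
  \<open>weight * bform\<close> at \<open>\<Sum>k. beta (v k) u *\<^sub>C x k - T (v k) (x k)\<close>, plus the boundary terms given
  by \<open>P\<^sub>-\<close>, \<open>P\<^sub>+\<close>, where \<open>beta\<close> takes the values \<open>1\<close> and \<open>-1\<close>.\<close>

theorem kernel_nonneg:
  fixes v :: "nat \<Rightarrow> complex" and x :: "nat \<Rightarrow> 'a"
  assumes v: "\<And>k. k < n \<Longrightarrow> cmod (v k) < 1"
    and ne: "\<And>k m. k < n \<Longrightarrow> m < n \<Longrightarrow> joukowski (v k) \<noteq> cnj (joukowski (v m))"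
  shows "(\<Sum>k<n. \<Sum>m<n. cinner (x k) (x m)
      - ((complex_of_real s)\<^sup>2 - cnj (joukowski (v m)) * joukowski (v k)) /
        (complex_of_real s * (joukowski (v k) - cnj (joukowski (v m)))) *
        (coeff (x k) (x m) (v k) - coeff (x k) (x m) (cnj (v m)))
      - cinner (T (v k) (x k)) (T (v m) (x m))) \<in> \<real>\<^sub>\<ge>\<^sub>0"
    (is "(\<Sum>k<n. \<Sum>m<n. ?K k m) \<in> _")
proof -
  define D where "D k = x k - T (v k) (x k)" for k
  define S where "S k = x k + T (v k) (x k)" for k
  define L where "L k m = (cinner (D k) (D m) + coeff (D k) (D m) (- complex_of_real \<rho>)) / 2" for k m
  define U where "U k m = (cinner (S k) (S m) - coeff (S k) (S m) (complex_of_real \<rho>)) / 2" for k m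
  define Y where "Y u k = beta (v k) u *\<^sub>C x k - T (v k) (x k)" for u k
  have "has_circle_mean (\<lambda>u. \<Sum>k<n. \<Sum>m<n. complex_of_real (weight u) * bform u (Y u k) (Y u m))
      (\<Sum>k<n. \<Sum>m<n. ?K k m - L k m - U k m)"
    unfolding Y_def L_def U_def D_def S_def
    by (intro has_circle_mean_sum pair_mean) (auto simp: v ne)
  moreover have "(\<Sum>k<n. \<Sum>m<n. complex_of_real (weight u) * bform u (Y u k) (Y u m)) \<in> \<real>\<^sub>\<ge>\<^sub>0"
    if u: "cmod u = 1" for u
  proof -
    have "(\<Sum>k<n. \<Sum>m<n. complex_of_real (weight u) * bform u (Y u k) (Y u m)) =
        complex_of_real (weight u) * bform u (\<Sum>k<n. Y u k) (\<Sum>k<n. Y u k)"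
      unfolding bform_sum_left bform_sum_right sum_distrib_left ..
    then show ?thesis
      using bform_nonneg[OF u] weight_nonneg[OF u]
      by (simp add: nonneg_Reals_mult_I)
  qed
  ultimately have mean: "(\<Sum>k<n. \<Sum>m<n. ?K k m - L k m - U k m) \<in> \<real>\<^sub>\<ge>\<^sub>0"
    by (rule has_circle_mean_nonneg)
  have half: "a / 2 \<in> \<real>\<^sub>\<ge>\<^sub>0" if "a \<in> \<real>\<^sub>\<ge>\<^sub>0" for a :: complex
    using that by (simp add: complex_nonneg_Reals_iff)
  have "(\<Sum>k<n. \<Sum>m<n. L k m) =
      (cinner (\<Sum>k<n. D k) (\<Sum>k<n. D k) + coeff (\<Sum>k<n. D k) (\<Sum>k<n. D k) (- complex_of_real \<rho>)) / 2"
    unfolding L_def blinfun.sum_right cinner.sum_left unfolding cinner.sum_right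
    by (simp add: sum.distrib sum_divide_distrib add_divide_distrib)
  then have L: "(\<Sum>k<n. \<Sum>m<n. L k m) \<in> \<real>\<^sub>\<ge>\<^sub>0"
    by (simp only: half lower)
  have "(\<Sum>k<n. \<Sum>m<n. U k m) =
      (cinner (\<Sum>k<n. S k) (\<Sum>k<n. S k) - coeff (\<Sum>k<n. S k) (\<Sum>k<n. S k) (complex_of_real \<rho>)) / 2"
    unfolding U_def blinfun.sum_right cinner.sum_left unfolding cinner.sum_right
    by (simp add: sum_subtractf sum_divide_distrib diff_divide_distrib)
  then have U: "(\<Sum>k<n. \<Sum>m<n. U k m) \<in> \<real>\<^sub>\<ge>\<^sub>0"
    by (simp only: half upper)
  have "(\<Sum>k<n. \<Sum>m<n. ?K k m) =
      (\<Sum>k<n. \<Sum>m<n. ?K k m - L k m - U k m) + (\<Sum>k<n. \<Sum>m<n. L k m) + (\<Sum>k<n. \<Sum>m<n. U k m)"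
    by (simp add: sum_subtractf)
  then show ?thesis
    using nonneg_Reals_add_I[OF nonneg_Reals_add_I[OF mean L] U] by simp
qed

end

section \<open>The domain, holomorphy of inverses and coercivity\<close>

lemma mem_E_dom: "z \<in> E_dom \<longleftrightarrow> Im z \<noteq> 0 \<or> \<bar>Re z\<bar> < 1"
proof -
  have "z \<in> complex_of_real ` ({..-1} \<union> {1..}) \<longleftrightarrow> Im z = 0 \<and> (Re z \<le> -1 \<or> 1 \<le> Re z)"
    by (auto simp: image_iff complex_eq_iff)
  then show ?thesis by (auto simp: E_dom_def)
qed

lemma E_dom_cnj: "z \<in> E_dom \<Longrightarrow> cnj z \<in> E_dom"
  by (simp add: mem_E_dom)

text \<open>Inside the disc the second factor is positive, so the map preserves the sign of the
  imaginary part. This carries the Nevanlinna sign condition over to the circle.\<close>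

lemma Im_joukowski:
  "Im (joukowski v) = Im v * (2 * (1 - (cmod v)\<^sup>2) / (cmod (1 + v\<^sup>2))\<^sup>2)"
proof -
  have "joukowski v = 2 * v * cnj (1 + v\<^sup>2) / complex_of_real ((cmod (1 + v\<^sup>2))\<^sup>2)"
    unfolding joukowski_def by (simp only: complex_div_cnj[of "2 * v"] of_real_power)
  moreover have "Im (2 * v * cnj (1 + v\<^sup>2)) = 2 * Im v * (1 - (cmod v)\<^sup>2)"
    unfolding cmod_power2 by (simp add: power2_eq_square algebra_simps)
  ultimately show ?thesis by (simp del: of_real_power)
qed

lemma joukowski_in_E_dom:
  assumes v: "cmod v < 1"
  shows "joukowski v \<in> E_dom"
proof (cases "Im v = 0")
  case True
  then have v_eq: "v = complex_of_real (Re v)" by (simp add: complex_eq_iff)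
  then have r: "\<bar>Re v\<bar> < 1" using v by (metis norm_of_real)
  have "0 < (1 - \<bar>Re v\<bar>)\<^sup>2" using r by simp
  then have "\<bar>2 * Re v / (1 + (Re v)\<^sup>2)\<bar> < 1"
    by (simp add: abs_mult divide_simps power2_eq_square algebra_simps add_pos_nonneg)
  then show ?thesis
    by (subst v_eq) (simp add: joukowski_of_real mem_E_dom del: of_real_mult of_real_divide)
next
  case False
  have "0 < 2 * (1 - (cmod v)\<^sup>2) / (cmod (1 + v\<^sup>2))\<^sup>2"
    using v one_plus_square_nonzero[OF v] by (simp add: abs_square_less_1 power_less_one_iff)
  then have "Im (joukowski v) \<noteq> 0"
    using False unfolding Im_joukowski by (simp only: mult_eq_0_iff less_irrefl) auto
  then show ?thesis by (simp add: mem_E_dom)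
qed

text \<open>The two solutions \<open>v\<close>, \<open>1 / v\<close> satisfy \<open>v + 1 / v = 2 / z\<close>; the sum is real on the unit circle.\<close>

lemma joukowski_surj:
  assumes z: "Im z \<noteq> 0"
  obtains v where "cmod v < 1" "joukowski v = z"
proof -
  define d q where "d = 1 / z" and "q = csqrt (d\<^sup>2 - 1)"
  have dz: "d * z = 1" using z by (auto simp: d_def)
  have q2: "q\<^sup>2 = d\<^sup>2 - 1" by (simp add: q_def)
  define v v' where "v = d + q" and "v' = d - q"
  have prod: "v * v' = 1" and eq: "v\<^sup>2 + 1 = 2 * d * v" "v'\<^sup>2 + 1 = 2 * d * v'"
    using q2 unfolding v_def v'_def by algebra+
  have "cmod v \<noteq> 1"
  proof
    assume "cmod v = 1"
    then have "v * cnj v = 1" by (simp add: complex_norm_square[symmetric])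
    with eq(1) prod have "2 * d = v + cnj v" by algebra
    then have "z * complex_of_real (Re v) = 1"
      using dz by (simp add: complex_add_cnj mult.commute)
    then have "Im z * Re v = 0" "Re z * Re v = 1" by (simp_all add: complex_eq_iff)
    then show False using z by simp
  qed
  moreover have "cmod v * cmod v' = 1" using prod by (metis norm_mult norm_one)
  ultimately have "cmod v < 1 \<or> cmod v' < 1"
    using mult_left_mono[of 1 "cmod v'" "cmod v"] by fastforce
  moreover have "joukowski w = z" if w: "w\<^sup>2 + 1 = 2 * d * w" "w \<noteq> 0" for w
  proof -
    have "d \<noteq> 0" using dz by auto
    then have "joukowski w = 1 / d"
      unfolding joukowski_def add.commute[of 1] w(1) using w(2) by simp
    then show ?thesis using dz by (simp add: d_def)
  qed
  ultimately show ?thesis using prod eq that by (metis mult_zero_left mult_zero_right zero_neq_one)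
qed

lemma holomorphic_joukowski: "joukowski holomorphic_on ball 0 1"
proof -
  have "(\<lambda>v. 2 * v / (1 + v\<^sup>2)) holomorphic_on ball 0 1"
    by (intro holomorphic_intros) (simp add: one_plus_square_nonzero)
  then show ?thesis by (simp add: joukowski_def[abs_def])
qed

section \<open>Complex derivatives of operator inverses, by difference quotients\<close>

lemma has_derivative_scaleC_iff:
  fixes F :: "complex \<Rightarrow> 'a :: complex_normed_vector"
  shows "(F has_derivative (\<lambda>h. h *\<^sub>C D)) (at z within S) \<longleftrightarrow>
    ((\<lambda>w. inverse (w - z) *\<^sub>C (F w - F z)) \<longlongrightarrow> D) (at z within S)"
proof -
  have "norm ((1 / norm (w - z)) *\<^sub>R (F w - (F z + (w - z) *\<^sub>C D))) =
      norm (inverse (w - z) *\<^sub>C (F w - F z) - D)" if "w \<noteq> z" for w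
  proof -
    have "inverse (w - z) *\<^sub>C (F w - F z) - D = inverse (w - z) *\<^sub>C (F w - F z - (w - z) *\<^sub>C D)"
      using that by (simp add: scaleC.diff_right scaleC_scaleC)
    then show ?thesis
      by (simp add: norm_scaleC norm_inverse divide_inverse diff_diff_add)
  qed
  then have ev: "\<forall>\<^sub>F w in at z within S. norm ((1 / norm (w - z)) *\<^sub>R (F w - (F z + (w - z) *\<^sub>C D))) =
      norm (inverse (w - z) *\<^sub>C (F w - F z) - D)"
    by (auto simp: eventually_at_filter)
  show ?thesis
    unfolding has_derivative_within
    using tendsto_cong[OF ev, of 0, unfolded tendsto_norm_zero_iff LIM_zero_iff]
      scaleC.bounded_linear_left by blast
qed

text \<open>The resolvent identity. Its case A = A' gives the uniqueness of inverses behind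
  \<open>op_inverse\<close>.\<close>

lemma blinfun_inverse_diff:
  assumes "B o\<^sub>L A = id_blinfun" "A' o\<^sub>L B' = id_blinfun"
  shows "B - B' = - (B o\<^sub>L (A - A') o\<^sub>L B')"
proof (rule blinfun_eqI)
  fix x
  have "blinfun_apply B (blinfun_apply A y) = y" for y
    using arg_cong[OF assms(1), of "\<lambda>T. blinfun_apply T y"] by simp
  moreover have "blinfun_apply A' (blinfun_apply B' x) = x"
    using arg_cong[OF assms(2), of "\<lambda>T. blinfun_apply T x"] by simp
  ultimately show "blinfun_apply (B - B') x = blinfun_apply (- (B o\<^sub>L (A - A') o\<^sub>L B')) x"
    by (simp add: blinfun.diff_left blinfun.minus_left blinfun.diff_right)
qed

text \<open>The inverses are given, so a Neumann series is avoided: the resolvent identity bounds |B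
  w - B z| by |B w| times \<delta> w, and once \<delta> w < 1/2 the part of |B w| coming from B w -
  B z is absorbed on the left, at the price of the factor 2.\<close>

lemma tendsto_blinfun_inverse:
  fixes A B :: "'b :: topological_space \<Rightarrow> 'a :: real_normed_vector \<Rightarrow>\<^sub>L 'a"
  assumes A: "(A \<longlongrightarrow> A z) (at z within S)" and z: "z \<in> S"
    and inv: "\<And>w. w \<in> S \<Longrightarrow> B w o\<^sub>L A w = id_blinfun" "\<And>w. w \<in> S \<Longrightarrow> A w o\<^sub>L B w = id_blinfun"
  shows "(B \<longlongrightarrow> B z) (at z within S)"
proof -
  define \<delta> where "\<delta> w = norm (A w - A z) * norm (B z)" for w
  have "(\<delta> \<longlongrightarrow> norm (A z - A z) * norm (B z)) (at z within S)"
    unfolding \<delta>_def by (intro tendsto_intros A)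
  then have \<delta>: "(\<delta> \<longlongrightarrow> 0) (at z within S)" by simp
  have "\<forall>\<^sub>F w in at z within S. norm (B w - B z) \<le> 2 * \<delta> w * norm (B z)"
  proof -
    have "norm (B w - B z) \<le> 2 * \<delta> w * norm (B z)" if w: "w \<in> S" "\<delta> w < 1 / 2" for w
    proof -
      have "norm (B w - B z) = norm (B w o\<^sub>L (A w - A z) o\<^sub>L B z)"
        by (simp add: blinfun_inverse_diff[OF inv(1)[OF w(1)] inv(2)[OF z]])
      also have "\<dots> \<le> norm (B w o\<^sub>L (A w - A z)) * norm (B z)"
        by (rule norm_blinfun_compose)
      also have "\<dots> \<le> (norm (B w) * norm (A w - A z)) * norm (B z)"
        by (intro mult_right_mono norm_blinfun_compose) simp
      finally have 1: "norm (B w - B z) \<le> norm (B w) * \<delta> w"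
        by (simp add: \<delta>_def mult.assoc)
      have \<delta>0: "0 \<le> \<delta> w" by (simp add: \<delta>_def)
      have "norm (B w) \<le> norm (B w - B z) + norm (B z)"
        by (metis diff_add_cancel norm_triangle_ineq)
      then have "norm (B w) * \<delta> w \<le> (norm (B w - B z) + norm (B z)) * \<delta> w"
        using \<delta>0 by (rule mult_right_mono)
      moreover have "norm (B w - B z) * \<delta> w \<le> norm (B w - B z) * (1 / 2)"
        using w by (intro mult_left_mono) auto
      ultimately show ?thesis using 1 by (simp add: algebra_simps)
    qed
    moreover have "\<forall>\<^sub>F w in at z within S. \<delta> w < 1 / 2"
      using order_tendstoD(2)[OF \<delta>, of "1 / 2"] by simp
    moreover have "\<forall>\<^sub>F w in at z within S. w \<in> S"
      by (simp add: eventually_at_filter)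
    ultimately show ?thesis by (auto elim: eventually_elim2)
  qed
  moreover have "((\<lambda>w. 2 * \<delta> w * norm (B z)) \<longlongrightarrow> 0) (at z within S)"
    using tendsto_mult_right[OF tendsto_mult_left[OF \<delta>, of 2], of "norm (B z)"] by simp
  ultimately have "((\<lambda>w. B w - B z) \<longlongrightarrow> 0) (at z within S)"
    by (rule Lim_null_comparison)
  then show ?thesis by (rule LIM_zero_cancel)
qed

lemma has_derivative_blinfun_inverse:
  fixes A B :: "complex \<Rightarrow> 'a :: complex_normed_vector \<Rightarrow>\<^sub>L 'a"
  assumes A: "(A has_derivative (\<lambda>h. h *\<^sub>C D)) (at z within S)" and z: "z \<in> S"
    and B: "\<And>w. w \<in> S \<Longrightarrow> B w \<in> bops"
    and inv: "\<And>w. w \<in> S \<Longrightarrow> B w o\<^sub>L A w = id_blinfun" "\<And>w. w \<in> S \<Longrightarrow> A w o\<^sub>L B w = id_blinfun"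
  shows "(B has_derivative (\<lambda>h. h *\<^sub>C (- (B z o\<^sub>L D o\<^sub>L B z)))) (at z within S)"
proof -
  have "continuous (at z within S) A"
    using A by (rule has_derivative_continuous)
  then have "(A \<longlongrightarrow> A z) (at z within S)" by (simp add: continuous_within)
  then have tB: "(B \<longlongrightarrow> B z) (at z within S)"
    using z inv by (rule tendsto_blinfun_inverse)
  note comp = bounded_bilinear.tendsto[OF bounded_bilinear_blinfun_compose]
  have "((\<lambda>w. - (B w o\<^sub>L (inverse (w - z) *\<^sub>C (A w - A z)) o\<^sub>L B z)) \<longlongrightarrow>
      - (B z o\<^sub>L D o\<^sub>L B z)) (at z within S)"
    by (intro tendsto_minus comp tB tendsto_const A[unfolded has_derivative_scaleC_iff])
  \<comment> \<open>The resolvent identity as an identity of difference quotients; complex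
    homogeneity of \<open>B w\<close> lets the scalar pass through it.\<close>
  moreover have "\<forall>\<^sub>F w in at z within S.
      - (B w o\<^sub>L (inverse (w - z) *\<^sub>C (A w - A z)) o\<^sub>L B z) = inverse (w - z) *\<^sub>C (B w - B z)"
  proof -
    have "- (B w o\<^sub>L (inverse (w - z) *\<^sub>C (A w - A z)) o\<^sub>L B z) = inverse (w - z) *\<^sub>C (B w - B z)"
      if "w \<in> S" for w
      unfolding blinfun_inverse_diff[OF inv(1)[OF that] inv(2)[OF z]]
      by (intro blinfun_eqI)
        (simp add: blinfun.minus_left bopsD[OF B[OF that]] scaleC.minus_right)
    then show ?thesis by (auto simp: eventually_at_filter)
  qed
  ultimately show ?thesis
    unfolding has_derivative_scaleC_iff by (rule Lim_transform_eventually)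
qed

text \<open>Lax--Milgram: \<open>x \<mapsto> x - t a (T x - y)\<close> is a contraction for small \<open>t > 0\<close>.\<close>

lemma coercive_boundedly_invertible:
  fixes T :: "'a :: chilbert_space \<Rightarrow>\<^sub>L 'a"
  assumes T: "T \<in> bops" and c: "0 < c" and a: "a \<noteq> 0"
    and coercive: "\<And>x. c * (norm x)\<^sup>2 \<le> Re (a * cinner (T x) x)"
  shows "boundedly_invertible T"
proof -
  \<comment> \<open>Adding \<open>c\<close> gives 0 < M and c \<le> M even when \<open>T\<close> is
    zero (on the zero space), so that the square root defining \<open>k\<close> below is of a
    nonnegative number less than 1.\<close>
  define M where "M = cmod a * norm T + c"
  have M: "0 < M" "c \<le> M" using c by (auto simp: M_def add_nonneg_pos)
  have bound: "c * norm x \<le> cmod a * norm (T x)" for x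
  proof (cases "x = 0")
    case False
    have "c * (norm x)\<^sup>2 \<le> cmod (a * cinner (T x) x)"
      using coercive[of x] complex_Re_le_cmod order_trans by blast
    also have "\<dots> \<le> cmod a * (norm (T x) * norm x)"
      by (simp add: norm_mult mult_left_mono norm_cinner_le)
    finally show ?thesis using False by (simp add: power2_eq_square)
  qed simp
  have surj: "\<exists>x. T x = y" for y
  proof -
    \<comment> \<open>The minimiser of 1 - 2 t c + t^2 M^2, whose minimum is 1 - c^2 / M^2 =
      k^2.\<close>
    define t where "t = c / M\<^sup>2"
    define g where "g x = x - t *\<^sub>R a *\<^sub>C (T x - y)" for x
    define k where "k = sqrt (1 - c\<^sup>2 / M\<^sup>2)"
    have t: "0 < t" using c M by (simp add: t_def)
    have cM: "0 \<le> 1 - c\<^sup>2 / M\<^sup>2" "1 - c\<^sup>2 / M\<^sup>2 < 1"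
      using c M by (simp_all add: power_mono)
    have k: "0 \<le> k" "k < 1" using cM c M by (auto simp: k_def)
    have "dist (g x) (g x') \<le> k * dist x x'" for x x'
    proof -
      define d where "d = x - x'"
      have sq: "(norm (d - t *\<^sub>R e))\<^sup>2 = (norm d)\<^sup>2 - 2 * t * inner e d + t\<^sup>2 * (norm e)\<^sup>2" for e
        unfolding power2_norm_eq_inner
        by (simp add: inner_diff inner_commute[of d e] power2_eq_square algebra_simps)
      have "g x - g x' = d - t *\<^sub>R a *\<^sub>C T d"
        by (simp add: g_def d_def blinfun.diff_right scaleC.diff_right scaleR_diff_right)
      then have "(norm (g x - g x'))\<^sup>2 =
          (norm d)\<^sup>2 - 2 * t * Re (a * cinner (T d) d) + t\<^sup>2 * (norm (a *\<^sub>C T d))\<^sup>2"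
        by (simp only: sq inner_eq_Re_cinner[of "a *\<^sub>C T d" d] cinner_scaleC_left)
      also have "\<dots> \<le> (norm d)\<^sup>2 - 2 * t * (c * (norm d)\<^sup>2) + t\<^sup>2 * (M * norm d)\<^sup>2"
      proof -
        have "norm (a *\<^sub>C T d) \<le> cmod a * (norm T * norm d)"
          by (simp add: norm_scaleC mult_left_mono norm_blinfun)
        also have "\<dots> \<le> M * norm d"
          using c by (simp add: M_def algebra_simps)
        finally have "t\<^sup>2 * (norm (a *\<^sub>C T d))\<^sup>2 \<le> t\<^sup>2 * (M * norm d)\<^sup>2"
          by (intro mult_left_mono power_mono) auto
        moreover have "2 * t * (c * (norm d)\<^sup>2) \<le> 2 * t * Re (a * cinner (T d) d)"
          using t coercive by (intro mult_left_mono) auto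
        ultimately show ?thesis by linarith
      qed
      also have "\<dots> = (1 - 2 * t * c + t\<^sup>2 * M\<^sup>2) * (norm d)\<^sup>2"
        by (simp add: algebra_simps power_mult_distrib)
      also have "1 - 2 * t * c + t\<^sup>2 * M\<^sup>2 = k\<^sup>2"
        using M cM by (simp add: k_def t_def power2_eq_square field_simps)
      finally have "(norm (g x - g x'))\<^sup>2 \<le> (k * norm d)\<^sup>2"
        by (simp only: power_mult_distrib)
      then have "norm (g x - g x') \<le> k * norm d"
        by (rule power2_le_imp_le) (use k in simp)
      then show ?thesis by (simp add: dist_norm d_def)
    qed
    with k have "\<exists>!x. g x = x"
      by (intro banach_fix_type[of k]) auto
    then obtain x where "g x = x" by blast
    then have "a *\<^sub>C (T x - y) = 0" using t by (simp add: g_def)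
    then have "norm (T x - y) = 0" using a norm_scaleC[of a "T x - y"] by simp
    then show ?thesis by auto
  qed
  have inj: "x = y" if "T x = T y" for x y
  proof -
    have "c * norm (x - y) \<le> 0"
      using bound[of "x - y"] that by (simp add: blinfun.diff_right)
    then show ?thesis using c by (simp add: mult_le_0_iff)
  qed
  obtain G where G: "\<And>y. T (G y) = y" using surj by metis
  have GT: "G (T x) = x" for x by (rule inj) (simp add: G)
  have bl: "bounded_linear G"
  proof (rule bounded_linear_intro)
    show "G (x + y) = G x + G y" for x y
      by (rule inj) (simp add: G blinfun.add_right)
    show "G (r *\<^sub>R x) = r *\<^sub>R G x" for x r
      by (rule inj) (simp add: G blinfun.scaleR_right)
    show "norm (G x) \<le> norm x * (cmod a / c)" for x
    proof -
      have "c * norm (G x) \<le> cmod a * norm x" using bound[of "G x"] by (simp only: G)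
      then show ?thesis using c by (simp add: pos_le_divide_eq mult.commute)
    qed
  qed
  have sc: "G (r *\<^sub>C x) = r *\<^sub>C G x" for r x
    by (rule inj) (simp add: G bopsD[OF T])
  show ?thesis
    unfolding boundedly_invertible_def
    by (rule bexI[of _ "Blinfun G"])
      (auto intro!: blinfun_eqI simp: bops_def bounded_linear_Blinfun_apply[OF bl] sc G GT)
qed

lemma op_inverse:
  assumes "boundedly_invertible T"
  shows "op_inverse T \<in> bops" "op_inverse T o\<^sub>L T = id_blinfun" "T o\<^sub>L op_inverse T = id_blinfun"
proof -
  obtain S where S: "S \<in> bops" "S o\<^sub>L T = id_blinfun" "T o\<^sub>L S = id_blinfun"
    using assms by (auto simp: boundedly_invertible_def)
  have "op_inverse T = S"
    unfolding op_inverse_def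
  proof (rule the_equality)
    fix S' assume S': "S' \<in> bops \<and> S' o\<^sub>L T = id_blinfun \<and> T o\<^sub>L S' = id_blinfun"
    have "S' - S = 0"
      by (rule trans[OF blinfun_inverse_diff[of S' T T S]]) (use S S' in auto)
    then show "S' = S" by simp
  qed (use S in auto)
  then show "op_inverse T \<in> bops" "op_inverse T o\<^sub>L T = id_blinfun" "T o\<^sub>L op_inverse T = id_blinfun"
    using S by auto
qed

section \<open>Nevanlinna functions on the domain\<close>

locale nevanlinna_on_E =
  fixes \<Omega> :: "complex \<Rightarrow> ('a :: chilbert_space \<Rightarrow>\<^sub>L 'a)"
  assumes nev: "nevanlinna \<Omega>" and hol: "op_holomorphic_on \<Omega> E_dom"
begin

lemma in_bops: "z \<in> E_dom \<Longrightarrow> \<Omega> z \<in> bops"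
  using hol by (simp add: op_holomorphic_on_def)

lemma continuous_on_E: "continuous_on E_dom \<Omega>"
  unfolding continuous_on_eq_continuous_within
  using hol by (auto simp: op_holomorphic_on_def intro: has_derivative_continuous)

lemma holomorphic_cinner: "(\<lambda>z. cinner (\<Omega> z x) y) holomorphic_on E_dom"
  unfolding holomorphic_on_def
proof
  fix z assume "z \<in> E_dom"
  then obtain D where D: "(\<Omega> has_derivative (\<lambda>h. h *\<^sub>C D)) (at z within E_dom)"
    using hol by (auto simp: op_holomorphic_on_def)
  have "bounded_linear (\<lambda>T. cinner (blinfun_apply T x) y)"
    by (intro bounded_linear_compose[OF cinner.bounded_linear_left] bounded_linear_intros)
  from bounded_linear.has_derivative[OF this D]
  have "((\<lambda>z. cinner (\<Omega> z x) y) has_derivative (\<lambda>h. h * cinner (D x) y)) (at z within E_dom)"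
    by (simp add: cinner_scaleC_left)
  then have "((\<lambda>z. cinner (\<Omega> z x) y) has_field_derivative cinner (D x) y) (at z within E_dom)"
    unfolding has_field_derivative_def
    by (rule has_derivative_eq_rhs) (simp add: fun_eq_iff mult.commute)
  then show "(\<lambda>z. cinner (\<Omega> z x) y) field_differentiable at z within E_dom"
    unfolding field_differentiable_def by blast
qed

section \<open>Transfer from the nonreal points to the interval (-1,1) by vertical limits\<close>

lemma approach_real:
  assumes "z \<in> E_dom" "Im z = 0"
  shows "((\<lambda>t. \<Omega> (z + complex_of_real t * \<i>)) \<longlongrightarrow> \<Omega> z) (at_right (0::real))"
    and "((\<lambda>t. \<Omega> (z - complex_of_real t * \<i>)) \<longlongrightarrow> \<Omega> z) (at_right (0::real))"
proof -
  have *: "((\<lambda>t. \<Omega> (z + of_real t * w)) \<longlongrightarrow> \<Omega> z) (at_right 0)" if w: "w = \<i> \<or> w = - \<i>" for w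
  proof (rule continuous_on_tendsto_compose[OF continuous_on_E _ assms(1)])
    have "((\<lambda>t. z + complex_of_real t * w) \<longlongrightarrow> z + complex_of_real 0 * w) (at_right 0)"
      by (intro tendsto_intros)
    then show "((\<lambda>t. z + complex_of_real t * w) \<longlongrightarrow> z) (at_right 0)" by simp
    show "\<forall>\<^sub>F t in at_right 0. z + complex_of_real t * w \<in> E_dom"
      unfolding eventually_at_right_field using w
      by (auto simp: mem_E_dom assms(2) intro!: exI[of _ "1::real"])
  qed
  show "((\<lambda>t. \<Omega> (z + complex_of_real t * \<i>)) \<longlongrightarrow> \<Omega> z) (at_right (0::real))"
    "((\<lambda>t. \<Omega> (z - complex_of_real t * \<i>)) \<longlongrightarrow> \<Omega> z) (at_right (0::real))"
    using *[of \<i>] *[of "- \<i>"] by simp_all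
qed

lemma op_adj_eq: "Im z \<noteq> 0 \<Longrightarrow> op_adj (\<Omega> z) = \<Omega> (cnj z)"
  using nev by (simp add: nevanlinna_def)

text \<open>\<open>nevanlinna\<close> speaks only of nonreal points. At a real point the approaches
  from above and below are conjugate to each other and have the same limit, so the operator there is
  selfadjoint.\<close>

lemma cinner_reflect:
  assumes z: "z \<in> E_dom"
  shows "cinner (\<Omega> z x) y = cinner x (\<Omega> (cnj z) y)"
proof (cases "Im z = 0")
  case False
  then show ?thesis using cinner_op_adj[OF in_bops[OF z]] op_adj_eq by simp
next
  case True
  then have cz: "cnj z = z" by (simp add: complex_eq_iff)
  have "\<forall>\<^sub>F t in at_right (0::real). cinner (\<Omega> (z + complex_of_real t * \<i>) x) y = cinner x (\<Omega> (z - complex_of_real t * \<i>) y)"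
    unfolding eventually_at_right_field
  proof (intro exI[of _ "1::real"] conjI allI impI)
    fix t :: real assume "t > 0"
    then have t: "Im (z + complex_of_real t * \<i>) \<noteq> 0" using True by simp
    have "cnj (z + complex_of_real t * \<i>) = z - complex_of_real t * \<i>" using cz by simp
    then show "cinner (\<Omega> (z + complex_of_real t * \<i>) x) y = cinner x (\<Omega> (z - complex_of_real t * \<i>) y)"
      using cinner_op_adj[of "\<Omega> (z + complex_of_real t * \<i>)" x y] op_adj_eq[OF t] in_bops[of "z + complex_of_real t * \<i>"] t
      by (simp add: mem_E_dom)
  qed simp
  moreover have "((\<lambda>t. cinner (\<Omega> (z + complex_of_real t * \<i>) x) y) \<longlongrightarrow> cinner (\<Omega> z x) y) (at_right 0)"
    by (intro cinner.tendsto blinfun.tendsto tendsto_const approach_real z True)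
  ultimately have "((\<lambda>t. cinner x (\<Omega> (z - complex_of_real t * \<i>) y)) \<longlongrightarrow> cinner (\<Omega> z x) y) (at_right 0)"
    by (rule Lim_transform_eventually[rotated])
  moreover have "((\<lambda>t. cinner x (\<Omega> (z - complex_of_real t * \<i>) y)) \<longlongrightarrow> cinner x (\<Omega> z y)) (at_right 0)"
    by (intro cinner.tendsto blinfun.tendsto tendsto_const approach_real z True)
  ultimately show ?thesis
    unfolding cz by (rule tendsto_unique[OF trivial_limit_at_right_real])
qed

lemma Im_cinner_nonneg:
  assumes z: "Im z \<noteq> 0"
  shows "0 \<le> Im z * Im (cinner (\<Omega> z x) x)"
proof -
  have "op_nonneg (Im z *\<^sub>R op_Im (\<Omega> z))" "\<Omega> z \<in> bops"
    using nev z in_bops[of z] by (auto simp: nevanlinna_def mem_E_dom)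
  then show ?thesis
    by (simp add: op_nonneg_def blinfun.scaleR_left cinner_simps cinner_op_Im
        flip: of_real_mult)
qed

lemma real_cinner:
  assumes "z \<in> E_dom" "Im z = 0"
  shows "cinner (\<Omega> z x) x = complex_of_real (Re (cinner (\<Omega> z x) x))"
proof -
  have "cnj z = z" using assms by (simp add: complex_eq_iff)
  then have "cinner (\<Omega> z x) x = cnj (cinner (\<Omega> z x) x)"
    using cinner_reflect[OF assms(1), of x x] cinner_commute by metis
  then show ?thesis by (simp add: complex_eq_iff)
qed

text \<open>The quadratic form of the operator in (ii). It is also the diagonal of
  \<open>K_kernel\<close> and, up to the factor \<open>Im z\<close>, the imaginary part of the form
  of \<open>Upsilon\<close> at \<open>pencil z x\<close>, so it links (ii), (iii) and (iv).\<close>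

definition defect :: "complex \<Rightarrow> 'a \<Rightarrow> real"
  where "defect z x = (norm x)\<^sup>2 - (norm (\<Omega> z x))\<^sup>2 -
    (1 - (cmod z)\<^sup>2) / Im z * Im (cinner (\<Omega> z x) x)"

lemma cinner_defect:
  assumes z: "Im z \<noteq> 0"
  shows "cinner (blinfun_apply (id_blinfun - (op_adj (\<Omega> z) o\<^sub>L \<Omega> z)
    - ((1 - (cmod z)\<^sup>2) / Im z) *\<^sub>R op_Im (\<Omega> z)) x) x = complex_of_real (defect z x)"
proof -
  have "\<Omega> z \<in> bops" using z by (simp add: in_bops mem_E_dom)
  then show ?thesis
    by (simp add: defect_def blinfun.diff_left blinfun.scaleR_left cinner_simps cinner_op_Im
        cinner_op_adj_left cinner_self)
qed

lemma op_nonneg_defect_iff: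
  assumes z: "Im z \<noteq> 0"
  shows "op_nonneg (id_blinfun - (op_adj (\<Omega> z) o\<^sub>L \<Omega> z)
    - ((1 - (cmod z)\<^sup>2) / Im z) *\<^sub>R op_Im (\<Omega> z)) \<longleftrightarrow> (\<forall>x. 0 \<le> defect z x)"
  unfolding op_nonneg_def cinner_defect[OF z] by simp

text \<open>Points just above (-1,1) lie in the unit disc, where the Nevanlinna sign makes the
  subtracted imaginary term nonnegative. Dropping it leaves a contraction, and the bound survives
  the vertical limit.\<close>

lemma norm_le_if_defect_nonneg:
  assumes defect: "\<And>z x. Im z \<noteq> 0 \<Longrightarrow> 0 \<le> defect z x"
    and z: "z \<in> E_dom" "Im z = 0"
  shows "norm (\<Omega> z x) \<le> norm x"
proof (rule tendsto_upperbound)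
  show "((\<lambda>t::real. norm (\<Omega> (z + complex_of_real t * \<i>) x)) \<longlongrightarrow> norm (\<Omega> z x)) (at_right 0)"
    by (intro tendsto_norm blinfun.tendsto tendsto_const approach_real z)
  have "((\<lambda>t. cmod (z + complex_of_real t * \<i>)) \<longlongrightarrow> cmod (z + complex_of_real 0 * \<i>)) (at_right 0)"
    by (intro tendsto_intros)
  moreover have "cmod (z + complex_of_real 0 * \<i>) < 1"
    using z by (simp add: mem_E_dom cmod_def)
  ultimately have "\<forall>\<^sub>F t in at_right 0. cmod (z + complex_of_real t * \<i>) < 1"
    by (rule order_tendstoD(2))
  moreover have "\<forall>\<^sub>F t in at_right (0::real). 0 < t"
    by (rule eventually_at_right_less)
  ultimately show "\<forall>\<^sub>F t in at_right (0::real). norm (\<Omega> (z + complex_of_real t * \<i>) x) \<le> norm x"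
  proof eventually_elim
    fix t :: real
    define w where "w = z + complex_of_real t * \<i>"
    assume "0 < t" "cmod (z + complex_of_real t * \<i>) < 1"
    then have w: "Im w \<noteq> 0" "cmod w < 1" using z by (auto simp: w_def)
    have "0 \<le> (1 - (cmod w)\<^sup>2) / (Im w)\<^sup>2 * (Im w * Im (cinner (\<Omega> w x) x))"
      by (rule mult_nonneg_nonneg[OF _ Im_cinner_nonneg[OF w(1)]]) (use w in \<open>simp add: power_le_one\<close>)
    also have "\<dots> = (1 - (cmod w)\<^sup>2) / Im w * Im (cinner (\<Omega> w x) x)"
      using w by (simp add: power2_eq_square)
    finally have "(norm (\<Omega> w x))\<^sup>2 \<le> (norm x)\<^sup>2"
      using defect[OF w(1), of x] unfolding defect_def by linarith
    then show "norm (\<Omega> (z + complex_of_real t * \<i>) x) \<le> norm x"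
      by (simp add: w_def power2_le_iff_abs_le)
  qed
qed simp

text \<open>Cauchy-Schwarz gives both operator bounds, and selfadjointness at real points gives the
  reality that \<open>op_nonneg\<close> demands.\<close>

lemma in_RS_if_norm_le:
  assumes "\<And>z x. z \<in> E_dom \<Longrightarrow> Im z = 0 \<Longrightarrow> norm (\<Omega> z x) \<le> norm x"
  shows "\<Omega> \<in> RS"
proof -
  have "op_le (- id_blinfun) (\<Omega> z) \<and> op_le (\<Omega> z) id_blinfun"
    if z: "z = complex_of_real r" "r \<in> {-1<..<1}" for z r
  proof -
    have zE: "z \<in> E_dom" "Im z = 0" using z by (auto simp: mem_E_dom)
    have "\<bar>Re (cinner (\<Omega> z x) x)\<bar> \<le> (norm x)\<^sup>2" for x
    proof -
      have "\<bar>Re (cinner (\<Omega> z x) x)\<bar> \<le> norm (\<Omega> z x) * norm x"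
        using abs_Re_le_cmod norm_cinner_le order_trans by blast
      also have "\<dots> \<le> norm x * norm x"
        using assms[OF zE] by (intro mult_right_mono) auto
      finally show ?thesis by (simp add: power2_eq_square)
    qed
    then have "0 \<le> Re (cinner (\<Omega> z x) x) + (norm x)\<^sup>2" "Re (cinner (\<Omega> z x) x) \<le> (norm x)\<^sup>2" for x
      by (simp_all only: abs_le_iff) (smt (verit) abs_le_iff)+
    moreover have "Im (cinner (\<Omega> z x) x) = 0" for x
      using real_cinner[OF zE, of x] by (simp add: complex_eq_iff)
    ultimately show ?thesis
      by (auto simp: op_le_def op_nonneg_def blinfun.diff_left blinfun.add_left cinner_simps cinner_self
          complex_nonneg_Reals_iff simp del: of_real_power)
  qed
  then show ?thesis using nev hol by (auto simp: RS_def)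
qed

lemma RS_bounds:
  assumes RS: "\<Omega> \<in> RS" and z: "z \<in> E_dom" "Im z = 0"
  shows "cinner x x + cinner (\<Omega> z x) x \<in> \<real>\<^sub>\<ge>\<^sub>0" "cinner x x - cinner (\<Omega> z x) x \<in> \<real>\<^sub>\<ge>\<^sub>0"
proof -
  have "z = complex_of_real (Re z)" "Re z \<in> {-1<..<1}"
    using z by (auto simp: mem_E_dom complex_eq_iff)
  then have "op_le (- id_blinfun) (\<Omega> z)" "op_le (\<Omega> z) id_blinfun"
    using RS by (simp_all only: RS_def mem_Collect_eq) metis+
  then show "cinner x x + cinner (\<Omega> z x) x \<in> \<real>\<^sub>\<ge>\<^sub>0" "cinner x x - cinner (\<Omega> z x) x \<in> \<real>\<^sub>\<ge>\<^sub>0"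
    by (simp_all add: op_le_def op_nonneg_def blinfun.diff_left blinfun.add_left cinner_simps add.commute)
qed

section \<open>Positivity of the kernel by exhausting the disc\<close>

lemma disc_family:
  assumes RS: "\<Omega> \<in> RS" and r: "0 < r" "r < 1"
  shows "disc_family (\<lambda>u. \<Omega> (joukowski (complex_of_real r * u))) r"
proof
  have small: "cmod (complex_of_real r * u) < 1" if "cmod u \<le> 1" for u
  proof -
    have "r * cmod u \<le> r * 1" using that r by (intro mult_left_mono) auto
    moreover have "cmod (complex_of_real r * u) = r * cmod u" using r by (simp add: norm_mult)
    ultimately show ?thesis using r by linarith
  qed
  then have inE: "joukowski (complex_of_real r * u) \<in> E_dom" if "cmod u \<le> 1" for u
    using that joukowski_in_E_dom by blast
  show "\<Omega> (joukowski (complex_of_real r * u)) \<in> bops" if "cmod u \<le> 1" for u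
    using in_bops inE that .
  show "cinner (\<Omega> (joukowski (complex_of_real r * u)) x) y =
      cinner x (\<Omega> (joukowski (complex_of_real r * cnj u)) y)" if "cmod u \<le> 1" for u x y
    using cinner_reflect[OF inE[OF that], of x y] by (simp flip: joukowski_cnj)
  show "(\<lambda>u. cinner (\<Omega> (joukowski (complex_of_real r * u)) x) y) holomorphic_on cball 0 1" for x y
  proof -
    have "(\<lambda>u. joukowski (complex_of_real r * u)) holomorphic_on cball 0 1"
      by (rule holomorphic_on_compose_gen[OF _ holomorphic_joukowski, unfolded o_def])
        (use small in \<open>auto intro!: holomorphic_intros\<close>)
    from holomorphic_on_compose_gen[OF this holomorphic_cinner[of x y]] show ?thesis
      using inE by (simp add: o_def image_subset_iff)
  qed
  show "0 \<le> Im u * Im (cinner (\<Omega> (joukowski (complex_of_real r * u)) x) x)"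
    if u: "cmod u = 1" for u x
  proof -
    define w where "w = complex_of_real r * u"
    define k where "k = 2 * (1 - (cmod w)\<^sup>2) / (cmod (1 + w\<^sup>2))\<^sup>2"
    have w: "cmod w < 1" using small u by (simp add: w_def)
    then have k: "0 < k"
      using one_plus_square_nonzero[OF w] by (simp add: k_def power_less_one_iff)
    have Im: "Im (joukowski w) = r * Im u * k"
      unfolding Im_joukowski k_def by (simp add: w_def)
    show ?thesis
    proof (cases "Im u = 0")
      case False
      then have "0 \<le> Im (joukowski w) * Im (cinner (\<Omega> (joukowski w) x) x)"
        using k r by (intro Im_cinner_nonneg) (simp add: Im)
      then have "0 \<le> (r * k) * (Im u * Im (cinner (\<Omega> (joukowski w) x) x))"
        by (simp add: Im mult_ac)
      moreover have "0 < r * k" using k r by simp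
      ultimately show ?thesis
        using mult_le_cancel_left_pos[of "r * k" 0] unfolding w_def by (metis mult_zero_right)
    qed simp
  qed
  \<comment> \<open>One parameter serves as scaling radius and as test point, so the bounds are
    taken at the real points \<open>joukowski\<close> of \<plusminus>r^2, inside (-1,1).\<close>
  have real: "Im (joukowski (complex_of_real r * complex_of_real t)) = 0" for t
    by (metis Im_complex_of_real joukowski_of_real of_real_mult)
  show "cinner x x + cinner (\<Omega> (joukowski (complex_of_real r * - complex_of_real r)) x) x \<in> \<real>\<^sub>\<ge>\<^sub>0" for x
    using RS_bounds(1)[OF RS inE[of "- complex_of_real r"]] real[of "- r"] r by simp
  show "cinner x x - cinner (\<Omega> (joukowski (complex_of_real r * complex_of_real r)) x) x \<in> \<real>\<^sub>\<ge>\<^sub>0" for x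
    using RS_bounds(2)[OF RS inE[of "complex_of_real r"]] real[of r] r by simp
qed (use r in auto)

lemma cinner_K_kernel:
  assumes "w \<in> E_dom" "Im w \<noteq> 0"
  shows "cinner (K_kernel \<Omega> z w x) y = cinner x y - (1 - cnj w * z) / (z - cnj w) *
    (cinner (\<Omega> z x) y - cinner (\<Omega> (cnj w) x) y) - cinner (\<Omega> z x) (\<Omega> w y)"
  using assms in_bops[OF assms(1)] cinner_reflect[of "cnj w"]
  by (simp add: K_kernel_def blinfun.diff_left cinner_simps cinner_op_adj_left E_dom_cnj)

text \<open>The preimages \<open>v k\<close> in the open disc stay fixed while r increases to 1;
  then \<open>T r u\<close> tends to \<open>\<Omega> (joukowski u)\<close> and s =
  \<open>\<sigma> r\<close> tends to 1, which turns the rescaled kernel into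
  \<open>K_kernel\<close>. For each finite sum, closedness of the nonnegative reals finishes the
  argument.\<close>

lemma K_kernel_nonneg:
  fixes z :: "nat \<Rightarrow> complex" and x :: "nat \<Rightarrow> 'a"
  assumes RS: "\<Omega> \<in> RS"
    and z: "\<And>k. k < n \<Longrightarrow> Im (z k) \<noteq> 0" "\<And>k m. k < n \<Longrightarrow> m < n \<Longrightarrow> z k \<noteq> cnj (z m)"
  shows "(\<Sum>k<n. \<Sum>m<n. cinner (K_kernel \<Omega> (z k) (z m) (x k)) (x m)) \<in> \<real>\<^sub>\<ge>\<^sub>0"
proof -
  have "\<forall>k. \<exists>v. k < n \<longrightarrow> cmod v < 1 \<and> joukowski v = z k"
    using joukowski_surj z(1) by metis
  then obtain v where v: "\<And>k. k < n \<Longrightarrow> cmod (v k) < 1" "\<And>k. k < n \<Longrightarrow> joukowski (v k) = z k"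
    by metis
  define \<sigma> :: "real \<Rightarrow> real" where "\<sigma> r = 2 * r / (1 + r\<^sup>2)" for r
  define T where "T r u = \<Omega> (joukowski (complex_of_real r * u))" for r u
  define K where "K r k m = cinner (x k) (x m)
      - ((complex_of_real (\<sigma> r))\<^sup>2 - cnj (z m) * z k) /
        (complex_of_real (\<sigma> r) * (z k - cnj (z m))) *
        (cinner (T r (v k) (x k)) (x m) - cinner (T r (cnj (v m)) (x k)) (x m))
      - cinner (T r (v k) (x k)) (T r (v m) (x m))" for r k m
  have "(\<Sum>k<n. \<Sum>m<n. K r k m) \<in> \<real>\<^sub>\<ge>\<^sub>0" if r: "0 < r" "r < 1" for r
  proof -
    interpret disc_family "T r" r
      unfolding T_def by (rule disc_family[OF RS r])
    have "(\<Sum>k<n. \<Sum>m<n. K r k m) = (\<Sum>k<n. \<Sum>m<n. cinner (x k) (x m)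
      - ((complex_of_real (\<sigma> r))\<^sup>2 - cnj (joukowski (v m)) * joukowski (v k)) /
        (complex_of_real (\<sigma> r) * (joukowski (v k) - cnj (joukowski (v m)))) *
        (cinner (T r (v k) (x k)) (x m) - cinner (T r (cnj (v m)) (x k)) (x m))
      - cinner (T r (v k) (x k)) (T r (v m) (x m)))"
      by (intro sum.cong refl) (simp add: K_def v)
    also have "\<dots> \<in> \<real>\<^sub>\<ge>\<^sub>0"
      unfolding \<sigma>_def using kernel_nonneg[of n v x] v z by (simp add: s_def)
    finally show ?thesis .
  qed
  moreover have "\<forall>\<^sub>F r in at_left (1::real). 0 < r \<and> r < 1"
    unfolding eventually_at_left_field by (intro exI[of _ 0]) auto
  ultimately have ev: "\<forall>\<^sub>F r in at_left 1. (\<Sum>k<n. \<Sum>m<n. K r k m) \<in> \<real>\<^sub>\<ge>\<^sub>0"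
    by (auto elim: eventually_mono)
  have T: "((\<lambda>r. T r u) \<longlongrightarrow> \<Omega> (joukowski u)) (at_left 1)" if u: "cmod u < 1" for u
    unfolding T_def
  proof (rule continuous_on_tendsto_compose[OF continuous_on_E _ joukowski_in_E_dom[OF u]])
    have "((\<lambda>r. 2 * (complex_of_real r * u) / (1 + (complex_of_real r * u)\<^sup>2)) \<longlongrightarrow>
        2 * (complex_of_real 1 * u) / (1 + (complex_of_real 1 * u)\<^sup>2)) (at_left 1)"
      by (intro tendsto_intros) (use one_plus_square_nonzero[OF u] in simp)
    then show "((\<lambda>r. joukowski (complex_of_real r * u)) \<longlongrightarrow> joukowski u) (at_left 1)"
      by (simp add: joukowski_def)
    have "cmod (complex_of_real r * u) < 1" if "0 < r \<and> r < 1" for r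
      using that u mult_strict_mono[of r 1 "cmod u" 1] by (simp add: norm_mult)
    then show "\<forall>\<^sub>F r in at_left 1. joukowski (complex_of_real r * u) \<in> E_dom"
      using \<open>\<forall>\<^sub>F r in at_left (1::real). 0 < r \<and> r < 1\<close> joukowski_in_E_dom
      by (auto elim: eventually_mono)
  qed
  have "(\<sigma> \<longlongrightarrow> 2 * 1 / (1 + 1\<^sup>2)) (at_left 1)"
    unfolding \<sigma>_def by (intro tendsto_intros) auto
  then have \<sigma>: "((\<lambda>r. complex_of_real (\<sigma> r)) \<longlongrightarrow> 1) (at_left 1)"
    using tendsto_of_real[of \<sigma> 1 "at_left 1", where 'a = complex] by simp
  have lim: "((\<lambda>r. K r k m) \<longlongrightarrow> cinner (K_kernel \<Omega> (z k) (z m) (x k)) (x m)) (at_left 1)"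
    if km: "k < n" "m < n" for k m
  proof -
    have "cmod (cnj (v m)) < 1" using v km by simp
    note T' = T[OF v(1)[OF km(1)]] T[OF v(1)[OF km(2)]] T[OF this]
    have "((\<lambda>r. K r k m) \<longlongrightarrow> cinner (x k) (x m)
      - (1\<^sup>2 - cnj (z m) * z k) / (1 * (z k - cnj (z m))) *
        (cinner (\<Omega> (joukowski (v k)) (x k)) (x m) - cinner (\<Omega> (joukowski (cnj (v m))) (x k)) (x m))
      - cinner (\<Omega> (joukowski (v k)) (x k)) (\<Omega> (joukowski (v m)) (x m))) (at_left 1)"
      unfolding K_def
      by (intro tendsto_intros cinner.tendsto blinfun.tendsto T' \<sigma>) (use z(2)[OF km] in simp)
    then show ?thesis
      using km z(1) by (simp add: cinner_K_kernel mem_E_dom joukowski_cnj v)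
  qed
  have closed: "closed (\<real>\<^sub>\<ge>\<^sub>0 :: complex set)" by (rule closed_nonneg_Reals_complex)
  show ?thesis
    by (rule Lim_in_closed_set[OF closed ev]) (auto intro!: tendsto_sum lim)
qed

lemma K_kernel_in_bops:
  assumes "z \<in> E_dom" "w \<in> E_dom"
  shows "K_kernel \<Omega> z w \<in> bops"
  unfolding K_kernel_def using assms by (intro bops_intros in_bops op_adj_in_bops)

lemma K_kernel_diagonal:
  assumes z: "Im z \<noteq> 0"
  shows "cinner (K_kernel \<Omega> z z x) x = complex_of_real (defect z x)"
proof -
  have zE: "z \<in> E_dom" using z by (simp add: mem_E_dom)
  have "cinner (\<Omega> (cnj z) x) x = cnj (cinner (\<Omega> z x) x)"
    using cinner_reflect[OF E_dom_cnj[OF zE], of x x] cinner_commute by (metis complex_cnj_cnj)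
  then have "cinner (\<Omega> z x) x - cinner (\<Omega> (cnj z) x) x =
      complex_of_real (2 * Im (cinner (\<Omega> z x) x)) * \<i>"
    by (simp add: complex_diff_cnj)
  moreover have "1 - cnj z * z = complex_of_real (1 - (cmod z)\<^sup>2)"
    by (simp add: complex_norm_square mult.commute del: of_real_power)
  moreover have "z - cnj z = complex_of_real (2 * Im z) * \<i>"
    by (simp add: complex_diff_cnj)
  ultimately show ?thesis
    unfolding cinner_K_kernel[OF zE z] using z
    by (simp add: defect_def cinner_self)
qed

lemma kernel_imp_defect:
  assumes up: "nonneg_kernel_on {z \<in> E_dom. Im z > 0} (K_kernel \<Omega>)"
    and low: "nonneg_kernel_on {z \<in> E_dom. Im z < 0} (K_kernel \<Omega>)"
    and z: "Im z \<noteq> 0"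
  shows "0 \<le> defect z x"
proof -
  have zE: "z \<in> E_dom" using z by (simp add: mem_E_dom)
  obtain S where S: "nonneg_kernel_on S (K_kernel \<Omega>)" "z \<in> S"
  proof (cases "Im z > 0")
    case True
    then show ?thesis using that[OF up] zE by simp
  next
    case False
    then show ?thesis using that[OF low] zE z by simp
  qed
  from S(1) have "cinner (K_kernel \<Omega> z z x) x \<in> \<real>\<^sub>\<ge>\<^sub>0"
    unfolding nonneg_kernel_on_def
    by (elim conjE allE[of _ "Suc 0"] allE[of _ "\<lambda>_. z"] allE[of _ "\<lambda>_. x"]) (use S(2) in simp)
  then show ?thesis by (simp add: K_kernel_diagonal[OF z])
qed

lemma RS_imp_kernel:
  assumes "\<Omega> \<in> RS"
  shows "nonneg_kernel_on {z \<in> E_dom. Im z > 0} (K_kernel \<Omega>)"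
    and "nonneg_kernel_on {z \<in> E_dom. Im z < 0} (K_kernel \<Omega>)"
proof -
  have "z \<noteq> cnj w" if "Im z > 0 \<and> Im w > 0 \<or> Im z < 0 \<and> Im w < 0" for z w
    using that by auto
  then show "nonneg_kernel_on {z \<in> E_dom. Im z > 0} (K_kernel \<Omega>)"
    "nonneg_kernel_on {z \<in> E_dom. Im z < 0} (K_kernel \<Omega>)"
    unfolding nonneg_kernel_on_def
    by (auto intro!: K_kernel_in_bops K_kernel_nonneg[OF assms])
qed

section \<open>Return from the kernel to the class\<close>

lemma RS_imp_defect:
  assumes "\<Omega> \<in> RS" "Im z \<noteq> 0"
  shows "0 \<le> defect z x"
  by (rule kernel_imp_defect[OF RS_imp_kernel[OF assms(1)] assms(2)])

text \<open>From -I \<le> A \<le> I to |A| \<le> 1 without spectral theory of A: the detour through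
  the defect already yields the norm bound.\<close>

lemma RS_norm_le:
  assumes "\<Omega> \<in> RS" "z \<in> E_dom" "Im z = 0"
  shows "norm (\<Omega> z x) \<le> norm x"
  using RS_imp_defect[OF assms(1)] assms(2,3) by (rule norm_le_if_defect_nonneg)

lemma RS_iff_defect: "\<Omega> \<in> RS \<longleftrightarrow> (\<forall>z. Im z \<noteq> 0 \<longrightarrow> (\<forall>x. 0 \<le> defect z x))"
proof
  assume "\<forall>z. Im z \<noteq> 0 \<longrightarrow> (\<forall>x. 0 \<le> defect z x)"
  then show "\<Omega> \<in> RS"
    by (intro in_RS_if_norm_le norm_le_if_defect_nonneg) auto
qed (simp add: RS_imp_defect)

end

section \<open>The transform \<open>\<Omega> \<mapsto> \<Upsilon>\<close>\<close>

lemma op_holomorphic_on_subset: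
  assumes "op_holomorphic_on F S" "T \<subseteq> S"
  shows "op_holomorphic_on F T"
  using assms unfolding op_holomorphic_on_def by (meson has_derivative_subset subsetD)

context nevanlinna_on_E
begin

definition pencil :: "complex \<Rightarrow> 'a \<Rightarrow>\<^sub>L 'a"
  where "pencil z = id_blinfun - z *\<^sub>C \<Omega> z"

lemma pencil_apply: "blinfun_apply (pencil z) x = x - z *\<^sub>C \<Omega> z x"
  by (simp add: pencil_def blinfun.diff_left)

lemma pencil_in_bops: "z \<in> E_dom \<Longrightarrow> pencil z \<in> bops"
  unfolding pencil_def by (intro bops_intros in_bops)

text \<open>Off the real axis \<open>Im \<Omega>\<close> and \<open>- Im (1 / z)\<close> have the same sign, so \<open>\<Omega> z - 1 / z\<close> is
  coercive.\<close>

lemma pencil_invertible_nonreal: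
  assumes z: "Im z \<noteq> 0"
  shows "boundedly_invertible (pencil z)"
proof (rule coercive_boundedly_invertible)
  have z0: "z \<noteq> 0" using z by auto
  show "pencil z \<in> bops" using z by (simp add: pencil_in_bops mem_E_dom)
  show "0 < (Im z)\<^sup>2 / (cmod z)\<^sup>2" using z z0 by simp
  \<comment> \<open>Division by z turns the pencil into 1/z - \<Omega> z; the factor
    \<open>\<i> * Im z\<close> makes -Im z times the imaginary part of its form a real part, as the
    coercivity criterion requires.\<close>
  show "\<i> * complex_of_real (Im z) / z \<noteq> 0" using z z0 by simp
  fix x
  have "\<i> * complex_of_real (Im z) / z * cinner (pencil z x) x =
      \<i> * complex_of_real (Im z) * (complex_of_real ((norm x)\<^sup>2) / z - cinner (\<Omega> z x) x)"
    using z0 by (simp add: pencil_apply cinner_simps cinner_self field_simps)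
  moreover have "Re (\<i> * complex_of_real (Im z) * (complex_of_real ((norm x)\<^sup>2) / z - cinner (\<Omega> z x) x)) =
      (Im z)\<^sup>2 / (cmod z)\<^sup>2 * (norm x)\<^sup>2 + Im z * Im (cinner (\<Omega> z x) x)"
  proof -
    have "Im (complex_of_real ((norm x)\<^sup>2) / z) = - (Im z / (cmod z)\<^sup>2 * (norm x)\<^sup>2)"
      by (simp add: Im_divide cmod_power2 del: of_real_power)
    moreover have "Re (\<i> * complex_of_real (Im z) * w) = - Im z * Im w" for w by simp
    ultimately show ?thesis
      by (simp only: minus_complex.sel) (simp add: power2_eq_square algebra_simps)
  qed
  ultimately show "(Im z)\<^sup>2 / (cmod z)\<^sup>2 * (norm x)\<^sup>2 \<le>
      Re (\<i> * complex_of_real (Im z) / z * cinner (pencil z x) x)"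
    using Im_cinner_nonneg[OF z, of x] by (metis le_add_same_cancel1)
qed

text \<open>The gain from imaginary parts degenerates on the real axis. Instead z \<Omega> z has
  norm at most |Re z| < 1, so the pencil itself is coercive with constant 1 - |Re z|.\<close>

lemma pencil_invertible_real:
  assumes RS: "\<Omega> \<in> RS" and z: "z \<in> E_dom" "Im z = 0"
  shows "boundedly_invertible (pencil z)"
proof (rule coercive_boundedly_invertible[where a = 1])
  have zr: "z = complex_of_real (Re z)" "\<bar>Re z\<bar> < 1"
    using z by (auto simp: mem_E_dom complex_eq_iff)
  show "pencil z \<in> bops" using z by (simp add: pencil_in_bops)
  show "0 < 1 - \<bar>Re z\<bar>" using zr by simp
  fix x
  have "\<bar>Re z * Re (cinner (\<Omega> z x) x)\<bar> \<le> \<bar>Re z\<bar> * (norm x)\<^sup>2"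
  proof -
    have "\<bar>Re (cinner (\<Omega> z x) x)\<bar> \<le> norm (\<Omega> z x) * norm x"
      using abs_Re_le_cmod norm_cinner_le order_trans by blast
    also have "\<dots> \<le> norm x * norm x"
      using RS_norm_le[OF RS z] by (intro mult_right_mono) auto
    finally show ?thesis
      by (simp add: abs_mult mult_left_mono power2_eq_square)
  qed
  moreover have "Re (1 * cinner (pencil z x) x) = (norm x)\<^sup>2 - Re z * Re (cinner (\<Omega> z x) x)"
    using z by (simp add: pencil_apply cinner_simps cinner_self del: of_real_power)
  ultimately show "(1 - \<bar>Re z\<bar>) * (norm x)\<^sup>2 \<le> Re (1 * cinner (pencil z x) x)"
    by (simp add: algebra_simps abs_le_iff)
qed simp

lemma pencil_invertible:
  "\<Omega> \<in> RS \<Longrightarrow> z \<in> E_dom \<Longrightarrow> boundedly_invertible (pencil z)"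
  using pencil_invertible_nonreal pencil_invertible_real by blast

text \<open>Every vector has the form \<open>pencil z x\<close>, so evaluating
  \<open>Upsilon\<close> there removes the inverse: later identities involve only x and
  \<open>\<Omega> z x\<close>.\<close>

lemma Upsilon_pencil:
  assumes "boundedly_invertible (pencil z)"
  shows "Upsilon \<Omega> z (pencil z x) = z *\<^sub>C x - \<Omega> z x"
proof -
  have "op_inverse (pencil z) (pencil z x) = x"
    using arg_cong[OF op_inverse(2)[OF assms], of "\<lambda>T. blinfun_apply T x"] by simp
  then show ?thesis
    by (simp add: Upsilon_def pencil_def[symmetric] blinfun.diff_left)
qed

lemma pencil_surj:
  assumes "boundedly_invertible (pencil z)"
  obtains y where "x = pencil z y"
proof (rule that)
  show "x = pencil z (op_inverse (pencil z) x)"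
    using arg_cong[OF op_inverse(3)[OF assms], of "\<lambda>T. blinfun_apply T x"] by simp
qed

text \<open>For real z the map (a, b) -> (a - z b, z a - b) preserves |a|^2 - |b|^2 up to the factor
  1 - z^2, because the cross terms cancel. With an invertible pencil and |z| < 1, contractivity of
  \<open>\<Omega> z\<close> and of \<open>Upsilon \<Omega> z\<close> are therefore
  equivalent.\<close>

lemma norm_pencil_diff:
  assumes "Im z = 0"
  shows "(norm (pencil z x))\<^sup>2 - (norm (z *\<^sub>C x - \<Omega> z x))\<^sup>2 =
    (1 - (Re z)\<^sup>2) * ((norm x)\<^sup>2 - (norm (\<Omega> z x))\<^sup>2)"
proof -
  have z: "z = complex_of_real (Re z)" using assms by (simp add: complex_eq_iff)
  have eqs: "pencil z x = x - Re z *\<^sub>R \<Omega> z x" "z *\<^sub>C x - \<Omega> z x = Re z *\<^sub>R x - \<Omega> z x"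
    unfolding pencil_apply scaleR_scaleC using z by simp_all
  show ?thesis
    unfolding eqs power2_norm_eq_inner
    by (simp add: inner_diff inner_commute[of "\<Omega> z x" x] power2_eq_square algebra_simps)
qed

lemma Im_cinner_pencil:
  assumes z: "Im z \<noteq> 0"
  shows "Im (cinner (z *\<^sub>C x - \<Omega> z x) (pencil z x)) = Im z * defect z x"
proof -
  define a where "a = cinner (\<Omega> z x) x"
  have "cinner x (\<Omega> z x) = cnj a" unfolding a_def by (rule cinner_commute)
  then have eq: "cinner (z *\<^sub>C x - \<Omega> z x) (pencil z x) =
      z * complex_of_real ((norm x)\<^sup>2) - complex_of_real ((cmod z)\<^sup>2) * cnj a - a +
      cnj z * complex_of_real ((norm (\<Omega> z x))\<^sup>2)"
    unfolding complex_norm_square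
    by (simp add: pencil_apply cinner_simps cinner_self a_def[symmetric] algebra_simps
        del: of_real_power)
  have "Im z * defect z x =
      Im z * (norm x)\<^sup>2 - Im z * (norm (\<Omega> z x))\<^sup>2 - (1 - (cmod z)\<^sup>2) * Im a"
    using z by (simp add: defect_def a_def[symmetric] right_diff_distrib)
  then show ?thesis
    unfolding eq by (simp add: algebra_simps del: of_real_power)
qed

text \<open>On x = \<open>pencil z f\<close> and y = \<open>pencil (cnj z) g\<close> both sides
  expand to the same expression by the symmetry of \<Omega>, so the adjoint of an inverse is never
  taken.\<close>

lemma Upsilon_reflect:
  assumes inv: "\<And>z. z \<in> E_dom \<Longrightarrow> boundedly_invertible (pencil z)" and z: "z \<in> E_dom"
  shows "cinner (Upsilon \<Omega> z x) y = cinner x (Upsilon \<Omega> (cnj z) y)"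
proof -
  note cz = E_dom_cnj[OF z]
  obtain f g where f: "x = pencil z f" and g: "y = pencil (cnj z) g"
    using pencil_surj[OF inv[OF z]] pencil_surj[OF inv[OF cz]] by metis
  have "cinner (\<Omega> z f) g = cinner f (\<Omega> (cnj z) g)"
    by (rule cinner_reflect[OF z])
  then show ?thesis
    unfolding f g Upsilon_pencil[OF inv[OF z]] Upsilon_pencil[OF inv[OF cz]]
    by (simp add: pencil_apply cinner_simps algebra_simps)
qed

lemma op_holomorphic_Upsilon:
  assumes inv: "\<And>z. z \<in> E_dom \<Longrightarrow> boundedly_invertible (pencil z)"
  shows "op_holomorphic_on (Upsilon \<Omega>) E_dom"
  unfolding op_holomorphic_on_def
proof (intro ballI conjI)
  fix z assume z: "z \<in> E_dom"
  define B where "B w = op_inverse (pencil w)" for w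
  define N where "N w = w *\<^sub>C id_blinfun - \<Omega> w" for w
  have U: "Upsilon \<Omega> = (\<lambda>w. N w o\<^sub>L B w)"
    by (simp add: fun_eq_iff Upsilon_def N_def B_def pencil_def)
  have B: "B w \<in> bops" "B w o\<^sub>L pencil w = id_blinfun" "pencil w o\<^sub>L B w = id_blinfun"
    if "w \<in> E_dom" for w
    unfolding B_def using op_inverse[OF inv[OF that]] by auto
  have N: "N z \<in> bops"
    unfolding N_def using z by (intro bops_intros in_bops)
  show "Upsilon \<Omega> z \<in> bops"
    unfolding U using N B(1)[OF z] by (rule bops_compose)
  obtain D where D: "D \<in> bops" "(\<Omega> has_derivative (\<lambda>h. h *\<^sub>C D)) (at z within E_dom)"
    using hol z by (auto simp: op_holomorphic_on_def)
  have dN: "(N has_derivative (\<lambda>h. h *\<^sub>C (id_blinfun - D))) (at z within E_dom)"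
    unfolding N_def
    by (rule has_derivative_eq_rhs[OF has_derivative_diff[OF bounded_linear.has_derivative[
        OF scaleC.bounded_linear_left has_derivative_ident] D(2)]])
      (simp add: fun_eq_iff scaleC.diff_right)
  have dA: "(pencil has_derivative (\<lambda>h. h *\<^sub>C (- (\<Omega> z + z *\<^sub>C D)))) (at z within E_dom)"
    unfolding pencil_def
    by (rule has_derivative_eq_rhs[OF has_derivative_diff[OF has_derivative_const
        scaleC.FDERIV[OF has_derivative_ident D(2)]]])
      (simp add: fun_eq_iff scaleC.minus_right scaleC.diff_right scaleC_scaleC mult.commute add.commute)
  define D' where "D' = - (B z o\<^sub>L (- (\<Omega> z + z *\<^sub>C D)) o\<^sub>L B z)"
  have dB: "(B has_derivative (\<lambda>h. h *\<^sub>C D')) (at z within E_dom)"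
    unfolding D'_def by (rule has_derivative_blinfun_inverse[OF dA z B])
  have "(Upsilon \<Omega> has_derivative (\<lambda>h. h *\<^sub>C ((N z o\<^sub>L D') + ((id_blinfun - D) o\<^sub>L B z))))
      (at z within E_dom)"
    unfolding U
    by (rule has_derivative_eq_rhs[OF bounded_bilinear.FDERIV[OF bounded_bilinear_blinfun_compose dN dB]])
      (auto simp: fun_eq_iff scaleC.add_right blinfun.add_left bopsD[OF N] intro!: blinfun_eqI)
  moreover have "(N z o\<^sub>L D') + ((id_blinfun - D) o\<^sub>L B z) \<in> bops"
    unfolding D'_def using N B(1)[OF z] D(1) in_bops[OF z] by (intro bops_intros)
  ultimately show "\<exists>D\<in>bops. (Upsilon \<Omega> has_derivative (\<lambda>h. h *\<^sub>C D)) (at z within E_dom)"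
    by blast
qed

lemma nevanlinna_Upsilon:
  assumes RS: "\<Omega> \<in> RS"
  shows "nevanlinna (Upsilon \<Omega>)"
  unfolding nevanlinna_def
proof (intro conjI allI impI)
  note inv = pencil_invertible[OF RS]
  have hol': "op_holomorphic_on (Upsilon \<Omega>) E_dom"
    using inv by (rule op_holomorphic_Upsilon)
  show "op_holomorphic_on (Upsilon \<Omega>) {z. Im z \<noteq> 0}"
    by (rule op_holomorphic_on_subset[OF hol']) (auto simp: mem_E_dom)
  fix z assume z: "Im z \<noteq> 0"
  have zE: "z \<in> E_dom" using z by (simp add: mem_E_dom)
  have bops: "Upsilon \<Omega> z \<in> bops" "Upsilon \<Omega> (cnj z) \<in> bops"
    using hol' zE E_dom_cnj[OF zE] by (auto simp: op_holomorphic_on_def)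
  show "op_adj (Upsilon \<Omega> z) = Upsilon \<Omega> (cnj z)"
    by (rule op_adj_eqI[OF bops(2) Upsilon_reflect[OF inv zE]])
  show "op_nonneg (Im z *\<^sub>R op_Im (Upsilon \<Omega> z))"
    unfolding op_nonneg_def
  proof
    fix x
    obtain y where y: "x = pencil z y" using pencil_surj[OF inv[OF zE]] .
    have "Im (cinner (Upsilon \<Omega> z x) x) = Im z * defect z y"
      unfolding y Upsilon_pencil[OF inv[OF zE]] by (rule Im_cinner_pencil[OF z])
    then have "cinner ((Im z *\<^sub>R op_Im (Upsilon \<Omega> z)) x) x =
        complex_of_real (Im z * Im z * defect z y)"
      by (simp add: blinfun.scaleR_left cinner_simps cinner_op_Im[OF bops(1)])
    moreover have "0 \<le> Im z * Im z * defect z y"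
      using RS_imp_defect[OF RS z] by simp
    ultimately show "cinner ((Im z *\<^sub>R op_Im (Upsilon \<Omega> z)) x) x \<in> \<real>\<^sub>\<ge>\<^sub>0"
      by (simp del: of_real_mult)
  qed
qed

lemma one_minus_Re_square_pos: "z \<in> E_dom \<Longrightarrow> Im z = 0 \<Longrightarrow> 0 < 1 - (Re z)\<^sup>2"
  by (simp add: mem_E_dom abs_square_less_1)

section \<open>Passage of the class through the transform, tested at real points\<close>

lemma Upsilon_in_RS:
  assumes RS: "\<Omega> \<in> RS"
  shows "Upsilon \<Omega> \<in> RS"
proof -
  note inv = pencil_invertible[OF RS]
  interpret \<Upsilon>: nevanlinna_on_E "Upsilon \<Omega>"
    using nevanlinna_Upsilon[OF RS] op_holomorphic_Upsilon[OF inv] by unfold_locales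
  show ?thesis
  proof (rule \<Upsilon>.in_RS_if_norm_le)
    fix z x assume z: "z \<in> E_dom" "Im z = 0"
    obtain y where y: "x = pencil z y" using pencil_surj[OF inv[OF z(1)]] .
    have "0 \<le> (1 - (Re z)\<^sup>2) * ((norm y)\<^sup>2 - (norm (\<Omega> z y))\<^sup>2)"
      using one_minus_Re_square_pos[OF z] RS_norm_le[OF RS z, of y]
      by (simp add: power_mono)
    then have "(norm (Upsilon \<Omega> z x))\<^sup>2 \<le> (norm x)\<^sup>2"
      using norm_pencil_diff[OF z(2), of y] unfolding y Upsilon_pencil[OF inv[OF z(1)]] by linarith
    then show "norm (Upsilon \<Omega> z x) \<le> norm x"
      by (rule power2_le_imp_le) simp
  qed
qed

text \<open>The contraction bound for \<open>Upsilon\<close> at \<open>pencil z x\<close>, read back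
  through \<open>norm_pencil_diff\<close> and divided by 1 - (Re z)^2 > 0, gives the one for
  \<Omega>. The transform is never inverted, since \<Omega> is already a Nevanlinna function on the
  domain.\<close>

lemma in_RS_if_Upsilon_in_RS:
  assumes inv: "\<And>z. z \<in> E_dom \<Longrightarrow> boundedly_invertible (pencil z)" and RS: "Upsilon \<Omega> \<in> RS"
  shows "\<Omega> \<in> RS"
proof -
  interpret \<Upsilon>: nevanlinna_on_E "Upsilon \<Omega>"
    using RS by unfold_locales (auto simp: RS_def)
  show ?thesis
  proof (rule in_RS_if_norm_le)
    fix z x assume z: "z \<in> E_dom" "Im z = 0"
    have "(norm (z *\<^sub>C x - \<Omega> z x))\<^sup>2 \<le> (norm (pencil z x))\<^sup>2"
      using \<Upsilon>.RS_norm_le[OF RS z, of "pencil z x"]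
      unfolding Upsilon_pencil[OF inv[OF z(1)]] by (rule power_mono) simp
    then have "0 \<le> (1 - (Re z)\<^sup>2) * ((norm x)\<^sup>2 - (norm (\<Omega> z x))\<^sup>2)"
      using norm_pencil_diff[OF z(2), of x] by linarith
    then have "(norm (\<Omega> z x))\<^sup>2 \<le> (norm x)\<^sup>2"
      using mult_le_cancel_left_pos[OF one_minus_Re_square_pos[OF z], of 0] by simp
    then show "norm (\<Omega> z x) \<le> norm x"
      by (rule power2_le_imp_le) simp
  qed
qed

end

theorem theorem4p1:
  fixes \<Omega> :: "complex \<Rightarrow> ('a :: chilbert_space \<Rightarrow>\<^sub>L 'a)"
  assumes separable: "separable_space (euclidean :: 'a topology)"
    and nevanlinna: "nevanlinna \<Omega>"
    and holomorphic: "op_holomorphic_on \<Omega> E_dom"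
  shows "(\<Omega> \<in> RS \<longleftrightarrow>
            (\<forall>z. Im z \<noteq> 0 \<longrightarrow>
               op_nonneg (id_blinfun - (op_adj (\<Omega> z) o\<^sub>L \<Omega> z)
                 - ((1 - (cmod z)\<^sup>2) / Im z) *\<^sub>R op_Im (\<Omega> z))))
       \<and> (\<Omega> \<in> RS \<longleftrightarrow>
            nonneg_kernel_on {z \<in> E_dom. Im z > 0} (K_kernel \<Omega>) \<and>
             nonneg_kernel_on {z \<in> E_dom. Im z < 0} (K_kernel \<Omega>))
       \<and> (\<Omega> \<in> RS \<longleftrightarrow>
            (\<forall>z\<in>E_dom. boundedly_invertible (id_blinfun - z *\<^sub>C \<Omega> z)) \<and> Upsilon \<Omega> \<in> RS)"
proof -
  interpret nevanlinna_on_E \<Omega>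
    using nevanlinna holomorphic by unfold_locales
  show ?thesis
  proof (intro conjI)
    show "\<Omega> \<in> RS \<longleftrightarrow> (\<forall>z. Im z \<noteq> 0 \<longrightarrow> op_nonneg (id_blinfun - (op_adj (\<Omega> z) o\<^sub>L \<Omega> z)
        - ((1 - (cmod z)\<^sup>2) / Im z) *\<^sub>R op_Im (\<Omega> z)))"
      unfolding RS_iff_defect using op_nonneg_defect_iff by simp
    show "\<Omega> \<in> RS \<longleftrightarrow> nonneg_kernel_on {z \<in> E_dom. Im z > 0} (K_kernel \<Omega>) \<and>
        nonneg_kernel_on {z \<in> E_dom. Im z < 0} (K_kernel \<Omega>)"
      using RS_imp_kernel kernel_imp_defect RS_iff_defect by blast
    show "\<Omega> \<in> RS \<longleftrightarrow>
        (\<forall>z\<in>E_dom. boundedly_invertible (id_blinfun - z *\<^sub>C \<Omega> z)) \<and> Upsilon \<Omega> \<in> RS"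
      using pencil_invertible Upsilon_in_RS in_RS_if_Upsilon_in_RS unfolding pencil_def by blast
  qed
qed

end
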